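(* Let $m \ge 7$ and let $e, d$ be integers. There is a non-degenerate face $F \subseteq \mathcal{C}_m$ of the Kunz cone with embedding dimension $\mathsf{e}(F) = e$ and $\dim F = d$ if any of the following holds: (a) $e = m-1$ and $d = m-1$; (b) $e = m-2$ and $\lfloor \tfrac12(m-1) \rfloor \le d \le m-2$; or (c) $2 \le e \le m-3$ and $2 \le d \le e$. Moreover, in each such case the face $F$ can be chosen Apéry, except when $m$ is even and $(e,d) = (m-2, \tfrac12 m - 1)$ or $(e,d) = (m-3, 1)$, in which case no non-degenerate face $F \subseteq \mathcal{C}_m$ with $\mathsf{e}(F) = e$ and $\dim F = d$ is Apéry.
   Context: Kunz cone. For an integer $m \ge 2$ write $\mathbb{Z}_m = \mathbb{Z}/m\mathbb{Z}$. The Kunz cone $\mathcal{C}_m \subseteq \mathbb{R}_{\ge 0}^{m-1}$, with coordinates indexed by $\mathbb{Z}_m \setminus \{0\}$, is the pointed rational polyhedral cone of all $x$ with $x_i + x_j \ge x_{i+j}$ for all $i,j \in \mathbb{Z}_m\setminus\{0\}$ with $i+j \ne 0$. Faces of $\mathcal{C}_m$ are its (nonempty) faces in the usual sense for polyhedral cones, i.e. intersections of facets, with $\mathcal{C}_m$ itself included; $\dim F = \dim_{\mathbb{R}} \operatorname{span}_{\mathbb{R}} F$. The interior $F^\circ$ of a face $F$ is the set of points of $F$ not lying in any face properly contained in $F$. A face $F$ is degenerate if some $x \in F^\circ$ has some coordinate $x_i = 0$, and non-degenerate otherwise. Apéry faces. An Apéry point is an integer point $(z_1,\ldots,z_{m-1})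 \in \mathbb{Z}^{m-1}$ with $z_i \equiv i \bmod m$ for each $i$. A face $F$ is Apéry if $F^\circ$ contains an Apéry point. Kunz nilsemigroup. For a non-degenerate face $F \subseteq \mathcal{C}_m$, pick $x \in F^\circ$ and set $x_0 = 0$. The Kunz nilsemigroup of $F$ is $N = \mathbb{Z}_m \cup \{\infty\}$ with the commutative operation $\oplus$ for which $\infty$ is nil ($a \oplus \infty = \infty$ for all $a$) and, for $a,b \in \mathbb{Z}_m$, $a \oplus b = a+b$ if $x_a + x_b = x_{a+b}$ and $a \oplus b = \infty$ otherwise. It does not depend on the choice of $x \in F^\circ$. The atoms of $N$ are the elements that cannot be written as a sum of two non-identity elements. The embedding dimension $\mathsf{e}(F)$ is the number of atoms of $N$. *)

theory Defs
  imports "HOL-Analysis.Analysis" "Berlekamp_Zassenhaus.Finite_Field"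
begin

text \<open>
  Throughout, \<open>'a mod_ring\<close> with \<open>'a :: nontriv\<close> is the ring of integers modulo
  \<open>m = CARD('a) \<ge> 2\<close>. The space of real vectors with coordinates indexed by the nonzero residues
  is the coordinate hyperplane \<open>x $ 0 = 0\<close> of \<open>real ^ 'a mod_ring\<close>, so the convention
  that \<open>x $ 0 = 0\<close>, used in the definition of the Kunz nilsemigroup, is built in.
\<close>

definition kunz_cone :: "(real ^ 'a::nontriv mod_ring) set" where
  "kunz_cone = {x. x $ 0 = 0 \<and> (\<forall>i. i \<noteq> 0 \<longrightarrow> x $ i \<ge> 0) \<and>
     (\<forall>i j. i \<noteq> 0 \<longrightarrow> j \<noteq> 0 \<longrightarrow> i + j \<noteq> 0 \<longrightarrow> x $ i + x $ j \<ge> x $ (i + j))}"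

definition kunz_face :: "(real ^ 'a::nontriv mod_ring) set \<Rightarrow> bool" where
  "kunz_face F \<longleftrightarrow> F face_of kunz_cone \<and> F \<noteq> {}"

definition face_interior :: "(real ^ 'a::nontriv mod_ring) set \<Rightarrow> (real ^ 'a mod_ring) set" where
  "face_interior F = {x \<in> F. \<forall>G. kunz_face G \<longrightarrow> G \<subset> F \<longrightarrow> x \<notin> G}"

definition degenerate :: "(real ^ 'a::nontriv mod_ring) set \<Rightarrow> bool" where
  "degenerate F \<longleftrightarrow> (\<exists>x \<in> face_interior F. \<exists>i. i \<noteq> 0 \<and> x $ i = 0)"

definition apery_point :: "real ^ 'a::nontriv mod_ring \<Rightarrow> bool" where
  "apery_point z \<longleftrightarrow> z $ 0 = 0 \<and>
     (\<forall>i. i \<noteq> 0 \<longrightarrow> (\<exists>k::int. z $ i = of_int k \<and> (of_int k :: 'a mod_ring) = i))"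

definition apery :: "(real ^ 'a::nontriv mod_ring) set \<Rightarrow> bool" where
  "apery F \<longleftrightarrow> (\<exists>z \<in> face_interior F. apery_point z)"

text \<open>The nil \<open>\<infinity>\<close> is represented by \<open>None\<close>.\<close>

fun nil_add :: "real ^ 'a::nontriv mod_ring \<Rightarrow>
    'a mod_ring option \<Rightarrow> 'a mod_ring option \<Rightarrow> 'a mod_ring option" where
  "nil_add x (Some a) (Some b) = (if x $ a + x $ b = x $ (a + b) then Some (a + b) else None)"
| "nil_add x None _ = None"
| "nil_add x _ None = None"

definition kunz_nilsemigroup :: "(real ^ 'a::nontriv mod_ring) set \<Rightarrow>
    'a mod_ring option \<Rightarrow> 'a mod_ring option \<Rightarrow> 'a mod_ring option" where
  "kunz_nilsemigroup F = nil_add (SOME x. x \<in> face_interior F)"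

text \<open>As usual for atoms, the identity element \<open>Some 0\<close> is not counted as an atom.\<close>

definition nil_atoms :: "(real ^ 'a::nontriv mod_ring) set \<Rightarrow> 'a mod_ring option set" where
  "nil_atoms F = {c. c \<noteq> Some 0 \<and>
     (\<nexists>a b. a \<noteq> Some 0 \<and> b \<noteq> Some 0 \<and> c = kunz_nilsemigroup F a b)}"

definition embdim :: "(real ^ 'a::nontriv mod_ring) set \<Rightarrow> nat" where
  "embdim F = card (nil_atoms F)"

text \<open>
  The interior of a face is nonempty, and for a non-degenerate face the operation does not depend
  on the chosen interior point. (The first statement also makes non-degeneracy non-vacuous.)
\<close>

lemma face_interior_nonempty:
  assumes "kunz_face F"
  shows "face_interior F \<noteq> {}"
proof -
  have "F face_of kunz_cone" "F \<noteq> {}"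
    using assms by (auto simp: kunz_face_def)
  then have "rel_interior F \<noteq> {}"
    using face_of_imp_convex rel_interior_eq_empty by blast
  moreover have "rel_interior F \<subseteq> face_interior F"
  proof
    fix x assume x: "x \<in> rel_interior F"
    have "x \<notin> G" if "kunz_face G" "G \<subset> F" for G
    proof -
      have "G face_of F"
        using that \<open>F face_of kunz_cone\<close> face_of_face[of F kunz_cone G]
        by (auto simp: kunz_face_def)
      then show ?thesis
        using face_of_disjoint_rel_interior[of G F] that x by auto
    qed
    then show "x \<in> face_interior F"
      using x rel_interior_subset by (auto simp: face_interior_def)
  qed
  ultimately show ?thesis by auto
qed

lemma nil_add_independent:
  fixes F :: "(real ^ 'a::nontriv mod_ring) set"
  assumes "kunz_face F" "\<not> degenerate F" and x: "x \<in> face_interior F" and y: "y \<in> face_interior F"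
  shows "nil_add x = nil_add y"
proof -
  have F: "F face_of kunz_cone"
    using assms(1) by (simp add: kunz_face_def)
  have imp: "v $ a + v $ b = v $ (a + b)"
    if uv: "u \<in> face_interior F" "v \<in> face_interior F" and eq: "u $ a + u $ b = u $ (a + b)"
    for u v :: "real ^ 'a mod_ring" and a b
  proof (cases "a = 0 \<or> b = 0 \<or> a + b = 0")
    case True
    have u: "u $ 0 = 0" "\<And>i. u $ i \<ge> 0" and v: "v $ 0 = 0"
    proof -
      have "u \<in> kunz_cone" "v \<in> kunz_cone"
        using uv F face_of_imp_subset by (auto simp: face_interior_def)
      then show "u $ 0 = 0" "\<And>i. u $ i \<ge> 0" "v $ 0 = 0"
        by (auto simp: kunz_cone_def) (metis order_refl)
    qed
    show ?thesis
    proof (cases "a = 0 \<or> b = 0")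
      case False
      then have "u $ a + u $ b = 0" using True eq u by simp
      then have "u $ a = 0" using u(2)[of a] u(2)[of b] by linarith
      then show ?thesis using assms(2) uv(1) False by (auto simp: degenerate_def)
    qed (use v in auto)
  next
    case False
    let ?n = "axis a 1 + axis b 1 - axis (a + b) 1 :: real ^ 'a mod_ring"
    have n: "?n \<bullet> z = z $ a + z $ b - z $ (a + b)" for z :: "real ^ 'a mod_ring"
      by (simp add: inner_diff_left inner_add_left inner_axis')
    let ?G = "F \<inter> {z. ?n \<bullet> z = 0}"
    have "?G face_of F"
    proof (rule face_of_Int_supporting_hyperplane_ge)
      show "convex F" using F face_of_imp_convex by blast
      fix z assume "z \<in> F"
      then have "z \<in> kunz_cone" using F face_of_imp_subset by blast
      then show "?n \<bullet> z \<ge> 0" using False unfolding n by (auto simp: kunz_cone_def)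
    qed
    moreover have "u \<in> ?G" using uv eq by (simp add: n face_interior_def)
    ultimately have "kunz_face ?G"
      using F face_of_trans by (auto simp: kunz_face_def)
    then have "\<not> ?G \<subset> F"
      using uv(1) \<open>u \<in> ?G\<close> by (auto simp: face_interior_def)
    then have "v \<in> ?G" using uv(2) by (auto simp: face_interior_def)
    then show ?thesis by (simp add: n)
  qed
  show ?thesis
  proof (intro ext)
    fix c d
    show "nil_add x c d = nil_add y c d"
      using imp[OF x y] imp[OF y x] by (cases c; cases d) auto
  qed
qed

end

theory Submission
  imports Defs
begin

text \<open>
  A non-degenerate face is determined by any of its interior points \<open>x\<close>: it consists of the points of
  the cone that satisfy all equations \<open>y a + y b = y (a + b)\<close> which hold at \<open>x\<close>, the tight equations
  (\<open>face_eq_tight_face\<close>). Its dimension is the dimension of the linear solution space of these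
  equations, and its atoms are the nonzero residues that are not the sum in a tight equation. So the
  existence claims ask for points with prescribed tight equations.

  With no or one decomposable residue \<open>c\<close> the tight equations are \<open>y a + y (c - a) = y c\<close> for
  disjoint pairs, hence independent, and every number of them from 0 to the number of pairs can be
  chosen (\<open>exists_face_single_apery\<close>, \<open>exists_face_single_even\<close>).
  With at least two decomposable residues, a point modelled on
  the numerical semigroup generated by an interval has a tight space of dimension 2, however many
  atoms it has; one obtains larger dimensions by reserving some residues as atoms that occur in no
  tight equation (\<open>exists_face_two_parameters\<close>).

  The coordinates of an Apery point are pairwise distinct, being distinct modulo \<open>m\<close>. Therefore at
  most one tight equation \<open>a + a = c\<close> exists for each \<open>c\<close>, whereas an even \<open>c\<close> has two halves if \<open>m\<close>
  is even. Counting equations then bounds the dimension of an Apery face from below. For one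
  decomposable residue this is already the claim (\<open>no_apery_face_dim_half\<close>); for rays with two
  decomposable residues almost all conceivable equations would have to be tight, and following the
  growth of the coordinates along them leads to a contradiction (\<open>no_apery_face_dim_1\<close>).
\<close>

section \<open>Faces of the Kunz cone and their tight equations\<close>

definition positive_point :: "real ^ 'a::nontriv mod_ring \<Rightarrow> bool" where
  "positive_point x \<longleftrightarrow> x \<in> kunz_cone \<and> (\<forall>i. i \<noteq> 0 \<longrightarrow> x $ i > 0)"

definition tight :: "real ^ 'a::nontriv mod_ring \<Rightarrow> 'a mod_ring \<Rightarrow> 'a mod_ring \<Rightarrow> bool" where
  "tight x a b \<longleftrightarrow> a \<noteq> 0 \<and> b \<noteq> 0 \<and> a + b \<noteq> 0 \<and> x $ a + x $ b = x $ (a + b)"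

definition tight_space :: "real ^ 'a::nontriv mod_ring \<Rightarrow> (real ^ 'a mod_ring) set" where
  "tight_space x = {y. y $ 0 = 0 \<and> (\<forall>a b. tight x a b \<longrightarrow> y $ a + y $ b = y $ (a + b))}"

definition tight_face :: "real ^ 'a::nontriv mod_ring \<Rightarrow> (real ^ 'a mod_ring) set" where
  "tight_face x = kunz_cone \<inter> tight_space x"

definition decomps :: "real ^ 'a::nontriv mod_ring \<Rightarrow> 'a mod_ring \<Rightarrow> 'a mod_ring set" where
  "decomps x c = {a. tight x a (c - a)}"

definition decomposable :: "real ^ 'a::nontriv mod_ring \<Rightarrow> 'a mod_ring set" where
  "decomposable x = {c. decomps x c \<noteq> {}}"

lemma subspace_tight_space: "subspace (tight_space x)"
  unfolding subspace_def tight_space_def mem_Collect_eq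
proof (intro conjI ballI allI impI)
  fix y z :: "real ^ 'a mod_ring" and a b and c :: real
  assume y: "y \<in> {y. y $ 0 = 0 \<and> (\<forall>a b. tight x a b \<longrightarrow> y $ a + y $ b = y $ (a + b))}"
  show "(c *\<^sub>R y) $ 0 = 0" using y by simp
  assume t: "tight x a b"
  have ya: "y $ a + y $ b = y $ (a + b)" using y t by blast
  show "(c *\<^sub>R y) $ a + (c *\<^sub>R y) $ b = (c *\<^sub>R y) $ (a + b)"
    unfolding ya[symmetric] vector_scaleR_component by (simp add: distrib_left)
  assume z: "z \<in> {y. y $ 0 = 0 \<and> (\<forall>a b. tight x a b \<longrightarrow> y $ a + y $ b = y $ (a + b))}"
  have za: "z $ a + z $ b = z $ (a + b)" using z t by blast
  show "(y + z) $ a + (y + z) $ b = (y + z) $ (a + b)"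
    unfolding vector_add_component ya[symmetric] za[symmetric] by simp
qed auto

lemma mem_tight_space_self: "positive_point x \<Longrightarrow> x \<in> tight_space x"
  by (auto simp: tight_space_def tight_def positive_point_def kunz_cone_def)

lemma mem_tight_face_self: "positive_point x \<Longrightarrow> x \<in> tight_face x"
  using mem_tight_space_self by (auto simp: tight_face_def positive_point_def)

lemma convex_kunz_cone: "convex (kunz_cone :: (real ^ 'a::nontriv mod_ring) set)"
proof (rule convexI)
  fix x y :: "real ^ 'a mod_ring" and u v :: real
  assume xy: "x \<in> kunz_cone" "y \<in> kunz_cone" and uv: "0 \<le> u" "0 \<le> v"
  have "u * x $ (i + j) + v * y $ (i + j) \<le> u * x $ i + v * y $ i + (u * x $ j + v * y $ j)"
    if "i \<noteq> 0" "j \<noteq> 0" "i + j \<noteq> 0" for i j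
  proof -
    have "u * x $ (i + j) \<le> u * (x $ i + x $ j)" "v * y $ (i + j) \<le> v * (y $ i + y $ j)"
      using xy uv that by (auto simp: kunz_cone_def intro!: mult_left_mono)
    then show ?thesis by (simp add: algebra_simps)
  qed
  then show "u *\<^sub>R x + v *\<^sub>R y \<in> kunz_cone"
    using xy uv by (auto simp: kunz_cone_def)
qed

text \<open>
  The inequalities that are not tight at \<^term>\<open>x\<close> have positive slack there, so they survive a small
  move in any direction; the tight ones survive a move inside the tight space.
\<close>

lemma tight_space_direction:
  assumes "positive_point x" "y \<in> tight_space x"
  shows "\<exists>\<epsilon>>0. x + \<epsilon> *\<^sub>R y \<in> kunz_cone"
proof -
  have stable: "\<forall>\<^sub>F \<epsilon> in at_right 0. p + \<epsilon> * q > 0" if "p > 0" for p q :: real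
  proof -
    have "((\<lambda>\<epsilon>. p + \<epsilon> * q) \<longlongrightarrow> p + 0 * q) (at_right 0)"
      by (intro tendsto_intros)
    then show ?thesis using that by (auto dest: order_tendstoD)
  qed
  have "\<forall>\<^sub>F \<epsilon> in at_right 0. \<forall>i. i \<noteq> 0 \<longrightarrow> (x + \<epsilon> *\<^sub>R y) $ i \<ge> 0"
  proof (rule eventually_all_finite)
    fix i
    show "\<forall>\<^sub>F \<epsilon> in at_right 0. i \<noteq> 0 \<longrightarrow> (x + \<epsilon> *\<^sub>R y) $ i \<ge> 0"
    proof (cases "i = 0")
      case False
      then have "x $ i > 0" using assms by (auto simp: positive_point_def)
      from stable[OF this, of "y $ i"] show ?thesis
        by eventually_elim auto
    qed auto
  qed
  moreover have "\<forall>\<^sub>F \<epsilon> in at_right 0. \<forall>i j. i \<noteq> 0 \<longrightarrow> j \<noteq> 0 \<longrightarrow> i + j \<noteq> 0 \<longrightarrow>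
      (x + \<epsilon> *\<^sub>R y) $ i + (x + \<epsilon> *\<^sub>R y) $ j \<ge> (x + \<epsilon> *\<^sub>R y) $ (i + j)"
  proof (intro eventually_all_finite)
    fix i j
    show "\<forall>\<^sub>F \<epsilon> in at_right 0. i \<noteq> 0 \<longrightarrow> j \<noteq> 0 \<longrightarrow> i + j \<noteq> 0 \<longrightarrow>
      (x + \<epsilon> *\<^sub>R y) $ i + (x + \<epsilon> *\<^sub>R y) $ j \<ge> (x + \<epsilon> *\<^sub>R y) $ (i + j)"
    proof (cases "i \<noteq> 0 \<and> j \<noteq> 0 \<and> i + j \<noteq> 0")
      case nz: True
      show ?thesis
      proof (cases "tight x i j")
        case True
        have "x + \<epsilon> *\<^sub>R y \<in> tight_space x" for \<epsilon>
          using subspace_tight_space mem_tight_space_self[OF assms(1)] assms(2)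
          by (intro subspace_add subspace_scale)
        then have "(x + \<epsilon> *\<^sub>R y) $ i + (x + \<epsilon> *\<^sub>R y) $ j = (x + \<epsilon> *\<^sub>R y) $ (i + j)" for \<epsilon>
          using True unfolding tight_space_def by blast
        then show ?thesis by simp
      next
        case False
        moreover have "x $ i + x $ j \<ge> x $ (i + j)"
          using assms nz by (auto simp: positive_point_def kunz_cone_def)
        ultimately have "x $ i + x $ j - x $ (i + j) > 0"
          using nz by (auto simp: tight_def)
        from stable[OF this, of "y $ i + y $ j - y $ (i + j)"] show ?thesis
          by eventually_elim (auto simp: algebra_simps)
      qed
    qed auto
  qed
  moreover have "\<forall>\<^sub>F \<epsilon> in at_right (0::real). \<epsilon> > 0"
    by (rule eventually_at_right_less)
  ultimately have "\<forall>\<^sub>F \<epsilon> in at_right 0. \<epsilon> > 0 \<and> x + \<epsilon> *\<^sub>R y \<in> kunz_cone"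
  proof eventually_elim
    case (elim \<epsilon>)
    have "(x + \<epsilon> *\<^sub>R y) $ 0 = 0"
      using assms by (auto simp: positive_point_def kunz_cone_def tight_space_def)
    with elim show ?case by (simp add: kunz_cone_def)
  qed
  then show ?thesis
    using eventually_happens trivial_limit_at_right_real by blast
qed

lemma kunz_face_tight_face:
  assumes "positive_point x"
  shows "kunz_face (tight_face x)"
proof -
  have "a \<in> tight_face x \<and> b \<in> tight_face x"
    if ab: "a \<in> kunz_cone" "b \<in> kunz_cone" and w: "w \<in> tight_face x" and seg: "w \<in> open_segment a b"
    for a b w
  proof -
    obtain u where u: "0 < u" "u < 1" "w = (1 - u) *\<^sub>R a + u *\<^sub>R b"
      using seg by (auto simp: in_segment)
    have "a $ i + a $ j = a $ (i + j) \<and> b $ i + b $ j = b $ (i + j)" if t: "tight x i j" for i j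
    proof -
      let ?a = "a $ i + a $ j - a $ (i + j)" and ?b = "b $ i + b $ j - b $ (i + j)"
      have ge: "?a \<ge> 0" "?b \<ge> 0"
        using ab t by (auto simp: kunz_cone_def tight_def)
      have "w $ i + w $ j = w $ (i + j)"
        using w t by (auto simp: tight_face_def tight_space_def)
      then have "(1 - u) * ?a + u * ?b = 0"
        unfolding u(3) by (simp add: algebra_simps)
      moreover have "(1 - u) * ?a \<ge> 0" "u * ?b \<ge> 0"
        using u ge by simp_all
      ultimately have "(1 - u) * ?a = 0" "u * ?b = 0" by linarith+
      then show ?thesis using u by auto
    qed
    then show ?thesis
      using ab by (auto simp: tight_face_def tight_space_def kunz_cone_def)
  qed
  moreover have "convex (tight_face x)"
    unfolding tight_face_def
    by (intro convex_Int convex_kunz_cone subspace_imp_convex subspace_tight_space)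
  moreover have "tight_face x \<subseteq> kunz_cone"
    by (simp add: tight_face_def)
  ultimately have "tight_face x face_of kunz_cone"
    unfolding face_of_def by blast
  then show ?thesis
    using mem_tight_face_self[OF assms] unfolding kunz_face_def by blast
qed

text \<open>
  From \<^term>\<open>x\<close> one can move a little further along the line that comes from a point \<^term>\<open>y\<close> of
  the tight face, so \<^term>\<open>x\<close> is inside a segment of the cone that ends in \<^term>\<open>y\<close>.
\<close>

lemma tight_face_subset:
  assumes x: "positive_point x" and G: "kunz_face G" "x \<in> G"
  shows "tight_face x \<subseteq> G"
proof
  fix y assume y: "y \<in> tight_face x"
  show "y \<in> G"
  proof (cases "y = x")
    case False
    have "x - y \<in> tight_space x"
      using y mem_tight_space_self[OF x] subspace_tight_space subspace_diff
      by (auto simp: tight_face_def)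
    then obtain \<epsilon> where \<epsilon>: "\<epsilon> > 0" "x + \<epsilon> *\<^sub>R (x - y) \<in> kunz_cone"
      using tight_space_direction x by blast
    define w where "w = x + \<epsilon> *\<^sub>R (x - y)"
    have "x = (1 - 1 / (1 + \<epsilon>)) *\<^sub>R y + (1 / (1 + \<epsilon>)) *\<^sub>R w"
    proof -
      have "(1 + \<epsilon>) *\<^sub>R x = \<epsilon> *\<^sub>R y + w"
        by (simp add: w_def algebra_simps)
      then have "(1 / (1 + \<epsilon>)) *\<^sub>R ((1 + \<epsilon>) *\<^sub>R x) = (1 / (1 + \<epsilon>)) *\<^sub>R (\<epsilon> *\<^sub>R y + w)"
        by simp
      moreover have "1 - 1 / (1 + \<epsilon>) = 1 / (1 + \<epsilon>) * \<epsilon>"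
        using \<epsilon>(1) by (simp add: field_simps)
      ultimately show ?thesis using \<epsilon>(1) by (simp add: scaleR_add_right)
    qed
    moreover have "w \<noteq> y"
    proof
      assume "w = y"
      then have "(1 + \<epsilon>) *\<^sub>R (x - y) = 0"
        by (simp add: w_def algebra_simps)
      then show False using \<epsilon>(1) False by simp
    qed
    ultimately have "x \<in> open_segment y w"
      unfolding in_segment using \<epsilon>(1) by (intro conjI exI[of _ "1 / (1 + \<epsilon>)"]) auto
    moreover have "y \<in> kunz_cone" "w \<in> kunz_cone"
      using y \<epsilon> by (auto simp: tight_face_def w_def)
    ultimately show ?thesis
      using G unfolding kunz_face_def face_of_def by blast
  qed (use G in auto)
qed

lemma face_interior_tight_face:
  "positive_point x \<Longrightarrow> x \<in> face_interior (tight_face x)"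
  using tight_face_subset[of x] mem_tight_face_self[of x] unfolding face_interior_def by blast

text \<open>
  A supporting hyperplane through an interior point of a face cuts out a subface that is not
  proper, so it contains the whole face.
\<close>
lemma face_inter_supporting_hyperplane:
  assumes "kunz_face F" "x \<in> face_interior F" "n \<bullet> x = 0" "\<And>z. z \<in> kunz_cone \<Longrightarrow> n \<bullet> z \<ge> 0"
  shows "F \<subseteq> {z. n \<bullet> z = 0}"
proof -
  have F: "F face_of kunz_cone" using assms(1) by (simp add: kunz_face_def)
  let ?G = "F \<inter> {z. n \<bullet> z = 0}"
  have "?G face_of F"
    using F assms(4) face_of_imp_subset
    by (intro face_of_Int_supporting_hyperplane_ge face_of_imp_convex[OF F]) blast
  moreover have "x \<in> ?G" using assms by (simp add: face_interior_def)
  ultimately have "kunz_face ?G"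
    using F face_of_trans by (auto simp: kunz_face_def)
  then have "\<not> ?G \<subset> F"
    using assms(2) \<open>x \<in> ?G\<close> by (auto simp: face_interior_def)
  then show ?thesis by auto
qed

lemma positive_point_face_interior:
  assumes "kunz_face F" "\<not> degenerate F" "x \<in> face_interior F"
  shows "positive_point x"
proof -
  have "x \<in> kunz_cone"
    using assms face_of_imp_subset by (auto simp: kunz_face_def face_interior_def)
  moreover have "x $ i \<noteq> 0" if "i \<noteq> 0" for i
    using assms(2,3) that by (auto simp: degenerate_def)
  ultimately show ?thesis
    by (auto simp: positive_point_def kunz_cone_def order_less_le)
qed

text \<open>
  This makes the choice of a non-degenerate face the same as the choice of a point with positive
  coordinates, and reduces every question about the face to the equations that are tight there.
\<close>
lemma face_eq_tight_face:
  assumes F: "kunz_face F" "x \<in> face_interior F" and x: "positive_point x"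
  shows "F = tight_face x"
proof
  show "tight_face x \<subseteq> F"
    using tight_face_subset[OF x F(1)] F(2) by (auto simp: face_interior_def)
  have cone: "F \<subseteq> kunz_cone"
    using F face_of_imp_subset by (auto simp: kunz_face_def)
  have "y $ a + y $ b = y $ (a + b)" if "y \<in> F" and t: "tight x a b" for y a b
  proof -
    let ?n = "axis a 1 + axis b 1 - axis (a + b) 1 :: real ^ 'a mod_ring"
    have n: "?n \<bullet> z = z $ a + z $ b - z $ (a + b)" for z :: "real ^ 'a mod_ring"
      by (simp add: inner_diff_left inner_add_left inner_axis')
    have "F \<subseteq> {z. ?n \<bullet> z = 0}"
      by (rule face_inter_supporting_hyperplane[OF F])
        (use t in \<open>auto simp: n tight_def kunz_cone_def\<close>)
    then show ?thesis using that by (auto simp: n)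
  qed
  then show "F \<subseteq> tight_face x"
    using cone by (auto simp: tight_face_def tight_space_def kunz_cone_def)
qed

lemma not_degenerate_tight_face:
  assumes x: "positive_point x"
  shows "\<not> degenerate (tight_face x)"
proof
  assume "degenerate (tight_face x)"
  then obtain y i where y: "y \<in> face_interior (tight_face x)" "i \<noteq> 0" "y $ i = 0"
    by (auto simp: degenerate_def)
  have "tight_face x \<subseteq> {z. axis i 1 \<bullet> z = 0}"
    by (rule face_inter_supporting_hyperplane[OF kunz_face_tight_face[OF x] y(1)])
      (use y in \<open>auto simp: inner_axis' kunz_cone_def\<close>)
  then have "x $ i = 0"
    using mem_tight_face_self[OF x] by (auto simp: inner_axis')
  then show False using x y by (auto simp: positive_point_def)
qed

lemma dim_tight_face:
  assumes x: "positive_point x"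
  shows "dim (tight_face x) = dim (tight_space x)"
proof (rule antisym)
  show "dim (tight_face x) \<le> dim (tight_space x)"
    by (rule dim_subset) (auto simp: tight_face_def)
  have "tight_space x \<subseteq> span (tight_face x)"
  proof
    fix y assume y: "y \<in> tight_space x"
    obtain \<epsilon> where \<epsilon>: "\<epsilon> > 0" "x + \<epsilon> *\<^sub>R y \<in> kunz_cone"
      using tight_space_direction x y by blast
    then have "x + \<epsilon> *\<^sub>R y \<in> tight_face x"
      using y mem_tight_space_self[OF x] subspace_tight_space
      by (auto simp: tight_face_def intro!: subspace_add subspace_scale)
    then have "(1 / \<epsilon>) *\<^sub>R ((x + \<epsilon> *\<^sub>R y) - x) \<in> span (tight_face x)"
      using mem_tight_face_self[OF x] by (intro span_scale span_diff span_base)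
    then show "y \<in> span (tight_face x)" using \<epsilon> by simp
  qed
  then show "dim (tight_space x) \<le> dim (tight_face x)"
    using dim_subset dim_span by metis
qed

lemma decomposable_iff: "c \<in> decomposable x \<longleftrightarrow> (\<exists>a b. tight x a b \<and> a + b = c)"
proof
  assume "c \<in> decomposable x"
  then obtain a where "tight x a (c - a)"
    by (auto simp: decomposable_def decomps_def)
  then show "\<exists>a b. tight x a b \<and> a + b = c"
    by (intro exI[of _ a] exI[of _ "c - a"]) simp
next
  assume "\<exists>a b. tight x a b \<and> a + b = c"
  then obtain a b where "tight x a b" "c = a + b" by blast
  then have "a \<in> decomps x c" by (simp add: decomps_def)
  then show "c \<in> decomposable x" by (auto simp: decomposable_def)
qed

text \<open>
  The nil is the sum of two nils, hence no atom; the atoms are the nonzero residues without a tight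
  decomposition.
\<close>
lemma embdim_eq:
  fixes F :: "(real ^ 'a::nontriv mod_ring) set"
  assumes F: "kunz_face F" "\<not> degenerate F" "x \<in> face_interior F"
  shows "embdim F = CARD('a) - 1 - card (decomposable x)"
proof -
  define y where "y = (SOME x. x \<in> face_interior F)"
  have "y \<in> face_interior F"
    unfolding y_def using F(3) by (rule someI)
  then have "nil_add y = nil_add x"
    using nil_add_independent F by blast
  then have eq: "kunz_nilsemigroup F = nil_add x"
    by (simp add: kunz_nilsemigroup_def y_def)
  have x: "positive_point x" using positive_point_face_interior F by blast
  have sum: "(\<exists>a b. a \<noteq> Some 0 \<and> b \<noteq> Some 0 \<and> Some c = nil_add x a b) \<longleftrightarrow> c \<in> decomposable x"
    if "c \<noteq> 0" for c
  proof
    assume "\<exists>a b. a \<noteq> Some 0 \<and> b \<noteq> Some 0 \<and> Some c = nil_add x a b"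
    then obtain a b where ab: "a \<noteq> Some 0" "b \<noteq> Some 0" "Some c = nil_add x a b" by blast
    then obtain a' b' where "a = Some a'" "b = Some b'"
      by (cases a; cases b) auto
    with ab that show "c \<in> decomposable x"
      by (auto simp: decomposable_iff tight_def split: if_splits)
  next
    assume "c \<in> decomposable x"
    then obtain a b where "tight x a b" "a + b = c" by (auto simp: decomposable_iff)
    then have "Some a \<noteq> Some 0 \<and> Some b \<noteq> Some 0 \<and> Some c = nil_add x (Some a) (Some b)"
      by (auto simp: tight_def)
    then show "\<exists>a b. a \<noteq> Some 0 \<and> b \<noteq> Some 0 \<and> Some c = nil_add x a b" by blast
  qed
  have "nil_atoms F = Some ` (UNIV - {0} - decomposable x)"
  proof (rule Set.set_eqI)
    fix c
    show "c \<in> nil_atoms F \<longleftrightarrow> c \<in> Some ` (UNIV - {0} - decomposable x)"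
    proof (cases c)
      case None
      have "nil_add x None None = None" by simp
      then show ?thesis unfolding nil_atoms_def eq None by force
    next
      case (Some a)
      then show ?thesis unfolding nil_atoms_def eq using sum[of a] by (cases "a = 0") auto
    qed
  qed
  then have "embdim F = card (UNIV - {0} - decomposable x)"
    by (simp add: embdim_def card_image)
  also have "\<dots> = CARD('a) - 1 - card (decomposable x)"
  proof -
    have "decomposable x \<subseteq> UNIV - {0}"
      by (auto simp: decomposable_iff tight_def)
    then show ?thesis
      by (simp add: card_Diff_subset)
  qed
  finally show ?thesis .
qed

section \<open>Counting tight equations\<close>

lemma mem_decomps_iff:
  "a \<in> decomps x c \<longleftrightarrow> c \<noteq> 0 \<and> a \<noteq> 0 \<and> a \<noteq> c \<and> x $ a + x $ (c - a) = x $ c"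
  by (auto simp: decomps_def tight_def)

lemma diff_mem_decomps: "a \<in> decomps x c \<Longrightarrow> c - a \<in> decomps x c"
  by (auto simp: mem_decomps_iff add.commute)

lemma tight_iff_decomps: "tight x a b \<longleftrightarrow> a \<in> decomps x (a + b)"
  by (simp add: decomps_def)

lemma mem_decomposable: "a \<in> decomps x c \<Longrightarrow> c \<in> decomposable x"
  by (auto simp: decomposable_def)

lemma tight_spaceD: "y \<in> tight_space x \<Longrightarrow> a \<in> decomps x c \<Longrightarrow> y $ a + y $ (c - a) = y $ c"
  by (auto simp: tight_space_def decomps_def)

lemma tight_spaceI:
  "y $ 0 = 0 \<Longrightarrow> (\<And>a b. tight x a b \<Longrightarrow> y $ a + y $ b = y $ (a + b)) \<Longrightarrow> y \<in> tight_space x"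
  by (simp add: tight_space_def)

text \<open>Both bounds come from the projection onto the coordinates in \<^term>\<open>B\<close>.\<close>

lemma dim_le_card_coordinates:
  fixes T :: "(real ^ 'n::finite) set"
  assumes T: "subspace T" and inj: "\<And>y. y \<in> T \<Longrightarrow> (\<forall>b\<in>B. y $ b = 0) \<Longrightarrow> y = 0"
  shows "dim T \<le> card B"
proof -
  define f where "f = (\<lambda>y::real ^ 'n. \<chi> b. if b \<in> B then y $ b else 0)"
  have lin: "linear f"
    by (rule linearI) (auto simp: f_def vec_eq_iff)
  have "inj_on f (span T)"
  proof (rule inj_onI)
    fix y z assume yz: "y \<in> span T" "z \<in> span T" "f y = f z"
    have "y - z \<in> T" using yz T by (metis span_eq_iff subspace_diff)
    moreover have "(y - z) $ b = 0" if "b \<in> B" for b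
      using yz(3) that by (simp add: f_def vec_eq_iff) metis
    ultimately show "y = z" using inj[of "y - z"] by simp
  qed
  then have "dim T = dim (f ` T)"
    using dim_image_eq[OF lin] by simp
  also have "f ` T \<subseteq> span ((\<lambda>b. axis b 1) ` B)"
  proof
    fix w assume "w \<in> f ` T"
    then obtain y where "w = f y" by blast
    then have "w = (\<Sum>b\<in>B. y $ b *\<^sub>R axis b 1)"
      by (simp add: vec_eq_iff f_def axis_def if_distrib[of "\<lambda>u. _ * u"] cong: if_cong)
    moreover have "(\<Sum>b\<in>B. y $ b *\<^sub>R axis b 1) \<in> span ((\<lambda>b. axis b 1) ` B)"
      by (intro span_sum span_scale span_base imageI)
    ultimately show "w \<in> span ((\<lambda>b. axis b 1) ` B)" by simp
  qed
  then have "dim (f ` T) \<le> dim (span ((\<lambda>b. axis b 1 :: real ^ 'n) ` B))"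
    by (rule dim_subset)
  also have "\<dots> \<le> card ((\<lambda>b. axis b 1 :: real ^ 'n) ` B)"
    unfolding dim_span by (rule dim_le_card') simp
  also have "\<dots> \<le> card B" by (simp add: card_image_le)
  finally show ?thesis by simp
qed

lemma card_coordinates_le_dim:
  fixes T :: "(real ^ 'n::finite) set"
  assumes v: "\<And>b. b \<in> B \<Longrightarrow> v b \<in> T"
    and dual: "\<And>b b'. b \<in> B \<Longrightarrow> b' \<in> B \<Longrightarrow> v b $ b' = (if b' = b then 1 else 0)"
  shows "card B \<le> dim T"
proof -
  define f where "f = (\<lambda>y::real ^ 'n. \<chi> b. if b \<in> B then y $ b else 0)"
  have lin: "linear f"
    by (rule linearI) (auto simp: f_def vec_eq_iff)
  have inj: "inj (\<lambda>b::'n. axis b (1::real))"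
    by (rule injI) (simp add: axis_eq_axis)
  have "(\<lambda>b. axis b 1) ` B \<subseteq> f ` T"
  proof
    fix w :: "real ^ 'n" assume "w \<in> (\<lambda>b. axis b 1) ` B"
    then obtain b where b: "b \<in> B" "w = axis b 1" by blast
    have "f (v b) = w"
      using dual[OF b(1)] b by (simp add: vec_eq_iff f_def axis_def)
    then show "w \<in> f ` T" using v[OF b(1)] by blast
  qed
  moreover have "independent ((\<lambda>b. axis b (1::real)) ` B)"
    by (rule independent_mono[OF independent_Basis]) (auto simp: axis_in_Basis_iff)
  ultimately have "card ((\<lambda>b. axis b (1::real)) ` B) \<le> dim (f ` T)"
    by (metis independent_card_le_dim)
  also have "\<dots> \<le> dim T" by (rule dim_image_le[OF lin])
  finally show ?thesis
    using inj by (simp add: card_image inj_on_subset)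
qed

text \<open>
  Imposing one linear equation lowers the dimension by at most one. It is enough to impose the
  equation of one of the two terms \<^term>\<open>a\<close> and \<^term>\<open>c - a\<close> of each tight decomposition.
\<close>
lemma dim_tight_space_ge:
  fixes x :: "real ^ 'a::nontriv mod_ring"
  assumes R: "\<And>c a. a \<in> decomps x c \<Longrightarrow> a \<in> R c \<or> c - a \<in> R c"
  shows "CARD('a) \<le> dim (tight_space x) + 1 + (\<Sum>c\<in>decomposable x. card (R c))"
proof -
  define eqn :: "'a mod_ring \<times> 'a mod_ring \<Rightarrow> real ^ 'a mod_ring"
    where "eqn = (\<lambda>(c, a). axis a 1 + axis (c - a) 1 - axis c 1)"
  define V where "V = insert (axis 0 1) (eqn ` Sigma (decomposable x) R)"
  let ?K = "{y \<in> UNIV. \<forall>v \<in> span V. orthogonal v y}"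
  have K: "?K \<subseteq> tight_space x"
  proof
    fix y assume y: "y \<in> ?K"
    have zero: "v \<bullet> y = 0" if "v \<in> V" for v
      using y span_base[OF that] by (auto simp: orthogonal_def)
    have eq: "y $ a + y $ (c - a) = y $ c" if "c \<in> decomposable x" "a \<in> R c" for a c
    proof -
      have "eqn (c, a) \<in> V" using that by (auto simp: V_def)
      then have "eqn (c, a) \<bullet> y = 0" by (rule zero)
      then show ?thesis by (simp add: eqn_def inner_diff_left inner_add_left inner_axis')
    qed
    show "y \<in> tight_space x"
    proof (rule tight_spaceI)
      show "y $ 0 = 0" using zero[of "axis 0 1"] by (simp add: V_def inner_axis')
      fix a b assume "tight x a b"
      then have a: "a \<in> decomps x (a + b)" by (simp add: tight_iff_decomps)
      then show "y $ a + y $ b = y $ (a + b)"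
        using R[OF a] eq[of "a + b" a] eq[of "a + b" b] mem_decomposable[OF a]
        by (auto simp: add.commute)
    qed
  qed
  have "card V \<le> 1 + card (eqn ` Sigma (decomposable x) R)"
    unfolding V_def using card_insert_le_m1 by (simp add: card_insert_if)
  also have "card (eqn ` Sigma (decomposable x) R) \<le> card (Sigma (decomposable x) R)"
    by (intro card_image_le) simp
  also have "\<dots> = (\<Sum>c\<in>decomposable x. card (R c))"
    by (simp add: card_SigmaI)
  finally have V: "card V \<le> 1 + (\<Sum>c\<in>decomposable x. card (R c))" by simp
  have "dim ?K + dim (span V) = dim (UNIV :: (real ^ 'a mod_ring) set)"
    by (rule dim_subspace_orthogonal_to_vectors) auto
  moreover have "dim (span V) \<le> card V"
    by (metis V_def card_eq_0_iff dim_le_card' dim_span finite finite_imageI finite_insert)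
  moreover have "dim ?K \<le> dim (tight_space x)"
    using K by (rule dim_subset)
  ultimately show ?thesis using V by simp
qed

text \<open>
  An involution on a finite set has a system of orbit representatives; orbits of size two are
  counted twice by the set, and fixed points once more by the last term.
\<close>

lemma involution_representatives:
  fixes f :: "'b \<Rightarrow> 'b" and ord :: "'b \<Rightarrow> int"
  assumes S: "finite S" and f: "\<And>a. a \<in> S \<Longrightarrow> f a \<in> S" "\<And>a. a \<in> S \<Longrightarrow> f (f a) = a" and ord: "inj ord"
  shows "\<exists>R \<subseteq> S. (\<forall>a\<in>S. a \<in> R \<or> f a \<in> R) \<and> 2 * card R = card S + card {a \<in> S. f a = a}"
proof -
  define R where "R = {a \<in> S. ord a \<le> ord (f a)}"
  have R: "R \<subseteq> S" by (auto simp: R_def)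
  have inj: "inj_on f S" by (rule inj_on_inverseI[of S f f]) (use f in auto)
  have cover: "a \<in> R \<or> f a \<in> R" if "a \<in> S" for a
    using that f by (auto simp: R_def)
  have "R \<union> f ` R = S"
  proof
    show "R \<union> f ` R \<subseteq> S" using R f by auto
    show "S \<subseteq> R \<union> f ` R"
      using cover f(2) by (metis (no_types, lifting) UnCI image_eqI subsetI)
  qed
  moreover have "R \<inter> f ` R = {a \<in> S. f a = a}"
  proof
    show "R \<inter> f ` R \<subseteq> {a \<in> S. f a = a}"
    proof
      fix a assume "a \<in> R \<inter> f ` R"
      then obtain b where "a \<in> R" "b \<in> R" "a = f b" by blast
      then have b: "b \<in> S" "f b \<in> R" using R by auto
      have "ord (f b) \<le> ord b" "ord b \<le> ord (f b)"
        using \<open>b \<in> R\<close> b(2) f(2)[OF b(1)] by (auto simp: R_def)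
      then have "f b = b" using ord by (meson antisym injD)
      then show "a \<in> {a \<in> S. f a = a}" using \<open>a = f b\<close> b(1) by simp
    qed
    show "{a \<in> S. f a = a} \<subseteq> R \<inter> f ` R"
      by (force simp: R_def image_iff)
  qed
  moreover have "card (f ` R) = card R"
    using inj R by (intro card_image) (rule inj_on_subset)
  moreover have "finite R" "finite (f ` R)" using R S by (auto intro: finite_subset)
  ultimately have "card R + card R = card S + card {a \<in> S. f a = a}"
    using card_Un_Int[of R "f ` R"] by simp
  then have "2 * card R = card S + card {a \<in> S. f a = a}" by simp
  moreover have "\<forall>a\<in>S. a \<in> R \<or> f a \<in> R" using cover by blast
  ultimately show ?thesis using R by blast
qed

text \<open>
  The tight equations with right-hand side \<^term>\<open>c\<close> are unordered pairs \<open>{a, c - a}\<close>, so there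
  are as many of them as half the number of their terms, a term with \<open>a + a = c\<close> counting twice.
\<close>

lemma codim_tight_space_le:
  fixes x :: "real ^ 'a::nontriv mod_ring"
  shows "2 * CARD('a) \<le> 2 * dim (tight_space x) + 2 +
    (\<Sum>c\<in>decomposable x. card (decomps x c) + card {a \<in> decomps x c. c - a = a})"
proof -
  have "\<exists>R \<subseteq> decomps x c. (\<forall>a\<in>decomps x c. a \<in> R \<or> c - a \<in> R) \<and>
      2 * card R = card (decomps x c) + card {a \<in> decomps x c. c - a = a}" for c
    by (rule involution_representatives[where ord = to_int_mod_ring])
      (auto simp: diff_mem_decomps to_int_mod_ring_hom.inj_f)
  then obtain R where R: "\<And>c. R c \<subseteq> decomps x c"
      "\<And>c a. a \<in> decomps x c \<Longrightarrow> a \<in> R c \<or> c - a \<in> R c"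
      "\<And>c. 2 * card (R c) = card (decomps x c) + card {a \<in> decomps x c. c - a = a}"
    by metis
  have "2 * CARD('a) \<le> 2 * dim (tight_space x) + 2 + (\<Sum>c\<in>decomposable x. 2 * card (R c))"
    using dim_tight_space_ge[of x R] R(2) by (simp flip: sum_distrib_left)
  then show ?thesis by (simp add: R(3))
qed

text \<open>
  With only one decomposable residue \<^term>\<open>c\<close> the equations involve disjoint pairs besides the
  coordinate \<^term>\<open>c\<close>, hence are independent.
\<close>

lemma dim_tight_space_single:
  fixes x :: "real ^ 'a::nontriv mod_ring"
  assumes c: "decomposable x \<subseteq> {c}"
    and R: "R \<subseteq> decomps x c" "\<And>a. a \<in> decomps x c \<Longrightarrow> a \<in> R \<or> c - a \<in> R"
      "\<And>a. a \<in> R \<Longrightarrow> c - a \<notin> R \<or> c - a = a"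
  shows "dim (tight_space x) = CARD('a) - 1 - card R"
proof (rule antisym)
  have "0 \<notin> R" using R(1) by (auto simp: mem_decomps_iff)
  then have card: "card (UNIV - {0} - R) = CARD('a) - 1 - card R"
    by (subst card_Diff_subset) auto
  show "dim (tight_space x) \<le> CARD('a) - 1 - card R"
    unfolding card[symmetric]
  proof (rule dim_le_card_coordinates[OF subspace_tight_space])
    fix y assume y: "y \<in> tight_space x" and zero: "\<forall>b\<in>UNIV - {0} - R. y $ b = 0"
    have y0: "y $ 0 = 0" using y by (simp add: tight_space_def)
    have "y $ a = 0" if a: "a \<in> R" for a
    proof -
      have ac: "a \<in> decomps x c" using R(1) a by blast
      then have "c \<noteq> 0" "c \<notin> R" "c - a \<noteq> 0"
        using R(1) by (auto simp: mem_decomps_iff)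
      then have "y $ c = 0" "c - a \<notin> R \<Longrightarrow> y $ (c - a) = 0" using zero by auto
      moreover have "y $ a + y $ (c - a) = y $ c" using tight_spaceD[OF y ac] .
      ultimately show ?thesis using R(3)[OF a] by fastforce
    qed
    then show "y = 0" using y0 zero by (auto simp: vec_eq_iff)
  qed
  have "(\<Sum>c'\<in>decomposable x. card (if c' = c then R else decomps x c')) \<le> card R"
    using c by (cases "decomposable x = {}") (auto simp: subset_singleton_iff)
  moreover have "CARD('a) \<le> dim (tight_space x) + 1 +
      (\<Sum>c'\<in>decomposable x. card (if c' = c then R else decomps x c'))"
    by (rule dim_tight_space_ge) (use R(2) in auto)
  ultimately show "CARD('a) - 1 - card R \<le> dim (tight_space x)" by linarith
qed

section \<open>Points with prescribed Kunz coordinates\<close>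

definition rep :: "'a::nontriv mod_ring \<Rightarrow> nat" where
  "rep a = nat (to_int_mod_ring a)"

lemma int_rep: "int (rep (a :: 'a::nontriv mod_ring)) = to_int_mod_ring a"
proof -
  have "to_int_mod_ring a \<in> range (to_int_mod_ring :: 'a mod_ring \<Rightarrow> int)" by blast
  then show ?thesis by (simp add: rep_def range_to_int_mod_ring)
qed

lemma rep_less: "rep (a :: 'a::nontriv mod_ring) < CARD('a)"
proof -
  have "to_int_mod_ring a \<in> range (to_int_mod_ring :: 'a mod_ring \<Rightarrow> int)" by blast
  then have "int (rep a) < int CARD('a)" by (simp add: range_to_int_mod_ring int_rep)
  then show ?thesis by simp
qed

lemma of_nat_rep [simp]: "of_nat (rep a) = a"
  by (simp add: of_nat_of_int_mod_ring int_rep)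

lemma rep_of_nat: "n < CARD('a) \<Longrightarrow> rep (of_nat n :: 'a::nontriv mod_ring) = n"
  by (simp add: rep_def of_nat_of_int_mod_ring)

lemma rep_0 [simp]: "rep 0 = 0"
  using rep_of_nat[of 0] by simp

lemma rep_eq_0_iff [simp]: "rep a = 0 \<longleftrightarrow> a = 0"
  by (metis of_nat_rep of_nat_0 rep_0)

lemma rep_pos_iff [simp]: "0 < rep a \<longleftrightarrow> a \<noteq> 0"
  by (simp add: zero_less_iff_neq_zero)

lemma rep_inject: "rep a = rep b \<longleftrightarrow> a = b"
  by (metis of_nat_rep)

lemma rep_add:
  fixes a b :: "'a::nontriv mod_ring"
  shows "rep (a + b) = (if rep a + rep b < CARD('a) then rep a + rep b else rep a + rep b - CARD('a))"
proof -
  have "int (rep (a + b)) = int (rep a + rep b) mod int CARD('a)"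
    by (simp add: int_rep to_int_mod_ring_add)
  then have eq: "rep (a + b) = (rep a + rep b) mod CARD('a)"
    by (metis of_nat_eq_iff zmod_int)
  show ?thesis
    using rep_less[of a] rep_less[of b] unfolding eq
    by (cases "rep a + rep b < CARD('a)") (simp_all add: le_mod_geq)
qed

lemma inj_on_of_nat: "inj_on (of_nat :: nat \<Rightarrow> 'a::nontriv mod_ring) {..<CARD('a)}"
  by (rule inj_onI) (metis lessThan_iff rep_of_nat)

lemma card_of_nat_image: "A \<subseteq> {..<CARD('a)} \<Longrightarrow> card (of_nat ` A :: 'a::nontriv mod_ring set) = card A"
  using inj_on_of_nat by (intro card_image) (rule inj_on_subset)

text \<open>
  Every Apery point is \<open>m * k i + i\<close> for integers \<open>k i\<close>, its Kunz coordinates. When the sum of two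
  residues wraps around, the inequality of the cone has an extra summand 1 on its left side; the
  last condition below is the inequality without it, so that only sums which do not wrap
  around can be tight.
\<close>

definition kunz_coordinates :: "nat \<Rightarrow> (nat \<Rightarrow> nat) \<Rightarrow> bool" where
  "kunz_coordinates m k \<longleftrightarrow> k 0 = 0 \<and>
     (\<forall>i j. 0 < i \<longrightarrow> 0 < j \<longrightarrow> i + j < m \<longrightarrow> k (i + j) \<le> k i + k j) \<and>
     (\<forall>i j. i < m \<longrightarrow> j < m \<longrightarrow> m < i + j \<longrightarrow> k (i + j - m) \<le> k i + k j)"

definition kunz_point :: "(nat \<Rightarrow> nat) \<Rightarrow> real ^ 'a::nontriv mod_ring" where
  "kunz_point k = (\<chi> i. real (CARD('a) * k (rep i) + rep i))"

context
  fixes k :: "nat \<Rightarrow> nat" and x :: "real ^ 'a::nontriv mod_ring"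
  assumes k: "kunz_coordinates CARD('a) k" and x_def: "x = kunz_point k"
begin

text \<open>
  Dividing the inequality between \<^term>\<open>a\<close> and \<^term>\<open>b\<close> by \<open>m\<close> gives \<open>k a + k b \<ge> k (a + b)\<close> when
  the representatives do not wrap around, and \<open>k a + k b + 1 \<ge> k (a + b)\<close> when they do.
\<close>
lemma kunz_point_slack:
  assumes "a \<noteq> 0" "b \<noteq> 0" "a + b \<noteq> 0"
  shows "x $ a + x $ b \<ge> x $ (a + b)"
    and "x $ a + x $ b = x $ (a + b) \<longleftrightarrow>
      rep a + rep b < CARD('a) \<and> k (rep a + rep b) = k (rep a) + k (rep b)"
proof -
  let ?m = "CARD('a)"
  have pos: "0 < rep a" "0 < rep b" "0 < rep (a + b)"
    using assms by simp_all
  have "(x $ a + x $ b \<ge> x $ (a + b)) \<and> (x $ a + x $ b = x $ (a + b) \<longleftrightarrow>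
      rep a + rep b < ?m \<and> k (rep a + rep b) = k (rep a) + k (rep b))"
  proof (cases "rep a + rep b < ?m")
    case True
    have sum: "x $ a + x $ b = real (?m * (k (rep a) + k (rep b)) + (rep a + rep b))"
      by (simp add: x_def kunz_point_def algebra_simps)
    have ab: "x $ (a + b) = real (?m * k (rep a + rep b) + (rep a + rep b))"
      using True by (simp add: x_def kunz_point_def rep_add)
    have "k (rep a + rep b) \<le> k (rep a) + k (rep b)"
      using k True pos by (simp add: kunz_coordinates_def)
    then have "?m * k (rep a + rep b) \<le> ?m * (k (rep a) + k (rep b))" by (rule mult_le_mono2)
    moreover have "?m * k (rep a + rep b) = ?m * (k (rep a) + k (rep b)) \<longleftrightarrow>
        k (rep a + rep b) = k (rep a) + k (rep b)"
      by simp
    ultimately show ?thesis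
      unfolding sum ab of_nat_le_iff of_nat_eq_iff using True by linarith
  next
    case False
    then have l: "rep (a + b) = rep a + rep b - ?m" "rep (a + b) + ?m = rep a + rep b"
      by (auto simp: rep_add)
    have "k (rep (a + b)) \<le> k (rep a) + k (rep b)"
      using k pos l(2) rep_less[of a] rep_less[of b] unfolding l(1) kunz_coordinates_def by simp
    then have "?m * k (rep (a + b)) \<le> ?m * (k (rep a) + k (rep b))" by (rule mult_le_mono2)
    then have "?m * k (rep (a + b)) + rep (a + b) < ?m * (k (rep a) + k (rep b)) + (rep a + rep b)"
      using l(2) zero_less_card_finite[where 'a='a] by linarith
    then have "x $ (a + b) < x $ a + x $ b"
      unfolding x_def kunz_point_def by (simp add: algebra_simps flip: of_nat_add of_nat_mult)
    then show ?thesis using False by simp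
  qed
  then show "x $ a + x $ b \<ge> x $ (a + b)" and "x $ a + x $ b = x $ (a + b) \<longleftrightarrow>
      rep a + rep b < ?m \<and> k (rep a + rep b) = k (rep a) + k (rep b)"
    by blast+
qed

lemma tight_kunz_point:
  "tight x a b \<longleftrightarrow>
     a \<noteq> 0 \<and> b \<noteq> 0 \<and> rep a + rep b < CARD('a) \<and> k (rep a + rep b) = k (rep a) + k (rep b)"
proof (cases "a = 0 \<or> b = 0 \<or> a + b = 0")
  case True
  have "\<not> rep a + rep b < CARD('a)" if "a \<noteq> 0" "b \<noteq> 0"
  proof
    assume "rep a + rep b < CARD('a)"
    then have "rep (a + b) = rep a + rep b" by (simp add: rep_add)
    then show False using True that by (metis rep_0 add_is_0 rep_eq_0_iff)
  qed
  then show ?thesis using True by (auto simp: tight_def)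
next
  case False
  then show ?thesis using kunz_point_slack(2) by (auto simp: tight_def)
qed

lemma positive_kunz_point: "positive_point x"
proof -
  have "x $ 0 = 0" using k by (simp add: x_def kunz_point_def kunz_coordinates_def)
  moreover have "x $ i > 0" if "i \<noteq> 0" for i
  proof -
    have "real (CARD('a) * k (rep i)) \<ge> 0" "real (rep i) > 0" using that by simp_all
    then show ?thesis unfolding x_def kunz_point_def vec_lambda_beta of_nat_add
      by (rule add_nonneg_pos)
  qed
  ultimately show ?thesis
    using kunz_point_slack(1) by (auto simp: positive_point_def kunz_cone_def less_imp_le)
qed

lemma apery_kunz_point: "apery_point x"
  unfolding apery_point_def
proof (intro conjI allI impI)
  show "x $ 0 = 0" using k by (simp add: x_def kunz_point_def kunz_coordinates_def)
  fix i :: "'a mod_ring"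
  have "(of_int (int (CARD('a) * k (rep i) + rep i)) :: 'a mod_ring) = i"
    by simp
  moreover have "x $ i = of_int (int (CARD('a) * k (rep i) + rep i))"
    by (simp add: x_def kunz_point_def)
  ultimately show "\<exists>l::int. x $ i = of_int l \<and> (of_int l :: 'a mod_ring) = i" by blast
qed

end

lemma tight_face_realizes:
  fixes x :: "real ^ 'a::nontriv mod_ring"
  assumes x: "positive_point x"
  shows "kunz_face (tight_face x)" "\<not> degenerate (tight_face x)"
    "embdim (tight_face x) = CARD('a) - 1 - card (decomposable x)"
    "dim (tight_face x) = dim (tight_space x)"
    "apery_point x \<Longrightarrow> apery (tight_face x)"
  using kunz_face_tight_face[OF x] not_degenerate_tight_face[OF x] dim_tight_face[OF x]
    face_interior_tight_face[OF x] embdim_eq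
  by (auto simp: apery_def)

section \<open>Faces with at most one decomposable residue\<close>

text \<open>
  Take \<open>c = m - 1\<close> as the only possible sum, with Kunz coordinate 4, and give all other residues
  the coordinate 2 or 3. Then only a pair of residues with coordinate 2 and sum \<open>m - 1\<close> is tight;
  \<^term>\<open>s\<close> is the number of such pairs. For \<open>s = 0\<close> no residue is decomposable at all. The bound on
  \<^term>\<open>s\<close> is the number of pairs that exist, including the residue \<open>(m - 1) / 2\<close> paired with itself
  if \<^term>\<open>m\<close> is odd.
\<close>
lemma exists_face_single_apery:
  fixes s :: nat
  assumes m: "m = CARD('a::nontriv)" "m \<ge> 2" and s: "2 * s \<le> m - 1"
  shows "\<exists>F :: (real ^ 'a mod_ring) set. kunz_face F \<and> \<not> degenerate F \<and> apery F \<and>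
    embdim F = (if s = 0 then m - 1 else m - 2) \<and> dim F = m - 1 - s"
proof -
  define k where "k i = (if i = 0 then 0 else if i = m - 1 then 4
    else if i \<le> s \<or> m - 1 - i \<le> s then 2 else 3 :: nat)" for i :: nat
  define x :: "real ^ 'a mod_ring" where "x = kunz_point k"
  define c :: "'a mod_ring" where "c = of_nat (m - 1)"
  define R :: "'a mod_ring set" where "R = of_nat ` {1..s}"
  have k: "kunz_coordinates CARD('a) k"
    unfolding kunz_coordinates_def m(1)[symmetric] by (auto simp: k_def)
  have rep_c: "rep c = m - 1" unfolding c_def using m by (intro rep_of_nat) simp
  have tight: "tight x a b \<longleftrightarrow>
      a \<noteq> 0 \<and> b \<noteq> 0 \<and> rep a + rep b = m - 1 \<and> (rep a \<le> s \<or> rep b \<le> s)" for a b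
  proof (cases "a = 0 \<or> b = 0")
    case False
    then have "rep a > 0" "rep b > 0" by auto
    then have "rep a + rep b < m \<and> k (rep a + rep b) = k (rep a) + k (rep b) \<longleftrightarrow>
        rep a + rep b = m - 1 \<and> (rep a \<le> s \<or> rep b \<le> s)"
      by (auto simp: k_def split: if_splits)
    then show ?thesis unfolding tight_kunz_point[OF k x_def] m(1)[symmetric] by blast
  qed (auto simp: tight_kunz_point[OF k x_def])
  have sum_c: "a + b = c \<longleftrightarrow> rep a + rep b = m - 1" if "a \<noteq> 0" "b \<noteq> 0" for a b
    using rep_less[of a] rep_less[of b] m that
    unfolding rep_inject[symmetric] rep_c rep_add by auto
  have decomps: "a \<in> decomps x c \<longleftrightarrow> a \<noteq> 0 \<and> a \<noteq> c \<and> rep a + rep (c - a) = m - 1 \<and>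
      (rep a \<le> s \<or> rep (c - a) \<le> s)" for a
    by (auto simp: decomps_def tight)
  have rep_diff: "rep (c - a) = m - 1 - rep a" "rep a \<le> m - 1" for a
  proof -
    show "rep a \<le> m - 1" using rep_less[of a] m by simp
    show "rep (c - a) = m - 1 - rep a"
    proof (cases "a = 0 \<or> c - a = 0")
      case True
      then show ?thesis using rep_c by auto
    next
      case False
      then show ?thesis using sum_c[of a "c - a"] by auto
    qed
  qed
  have R_iff: "a \<in> R \<longleftrightarrow> 1 \<le> rep a \<and> rep a \<le> s" for a
  proof
    assume "a \<in> R"
    then obtain i where "a = of_nat i" "1 \<le> i" "i \<le> s" by (auto simp: R_def)
    then show "1 \<le> rep a \<and> rep a \<le> s" using s m rep_of_nat[of i, where 'a='a] by auto
  next
    assume "1 \<le> rep a \<and> rep a \<le> s"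
    then have "of_nat (rep a) \<in> R" unfolding R_def by (intro imageI) simp
    then show "a \<in> R" by simp
  qed
  have card_R: "card R = s"
    unfolding R_def using s m by (subst card_of_nat_image) auto
  have dec: "decomposable x \<subseteq> {c}"
    by (auto simp: decomposable_iff tight sum_c)
  have R_decomps: "R \<subseteq> decomps x c"
    using s m by (auto simp: R_iff decomps rep_diff rep_c)
  have dim: "dim (tight_space x) = m - 1 - s"
    unfolding card_R[symmetric] m(1)
  proof (rule dim_tight_space_single[OF dec])
    show "R \<subseteq> decomps x c" by (rule R_decomps)
    show "a \<in> R \<or> c - a \<in> R" if "a \<in> decomps x c" for a
    proof -
      have "a \<noteq> 0" "c - a \<noteq> 0" "rep a \<le> s \<or> rep (c - a) \<le> s"
        using that by (auto simp: decomps)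
      then show ?thesis by (simp add: R_iff Suc_le_eq zero_less_iff_neq_zero)
    qed
    show "c - a \<notin> R \<or> c - a = a" if "a \<in> R" for a
      using that s by (auto simp: R_iff rep_diff simp flip: rep_inject)
  qed
  have "card (decomposable x) = (if s = 0 then 0 else 1)"
  proof (cases "s = 0")
    case True
    then have "\<not> tight x a b" for a b unfolding tight by (metis le_zero_eq rep_eq_0_iff)
    then have "c \<notin> decomposable x" for c unfolding decomposable_iff by blast
    then have "decomposable x = {}" by blast
    then show ?thesis using True by simp
  next
    case False
    then have "1 < CARD('a)" using s m by linarith
    then have "rep (of_nat 1 :: 'a mod_ring) = 1" by (rule rep_of_nat)
    then have "of_nat 1 \<in> R" unfolding R_iff using False by linarith
    then have "c \<in> decomposable x" using R_decomps mem_decomposable by blast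
    then have "decomposable x = {c}" using dec by blast
    then show ?thesis using False by simp
  qed
  then have "embdim (tight_face x) = (if s = 0 then m - 1 else m - 2)"
    using tight_face_realizes(3)[OF positive_kunz_point[OF k x_def]] m by auto
  then show ?thesis
    using tight_face_realizes[OF positive_kunz_point[OF k x_def]] apery_kunz_point[OF k x_def] dim
    by metis
qed

text \<open>
  For even \<^term>\<open>m\<close> and even \<^term>\<open>c\<close> there are two residues with \<open>a + a = c\<close>, which gives one more
  equation than an odd \<^term>\<open>c\<close> does. Both of them get half the coordinate of \<^term>\<open>c\<close>, so such a
  point is not an Apery point.
\<close>

lemma exists_face_single_even:
  assumes m: "m = CARD('a::nontriv)" "m \<ge> 4" "even m"
  shows "\<exists>F :: (real ^ 'a mod_ring) set. kunz_face F \<and> \<not> degenerate F \<and>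
    embdim F = m - 2 \<and> dim F = m div 2 - 1"
proof -
  define c :: "'a mod_ring" where "c = of_nat (m - 2)"
  define x :: "real ^ 'a mod_ring" where "x = (\<chi> i. if i = 0 then 0 else if i = c then 2 else 1)"
  define A where "A = insert (m - 1) {1..m div 2 - 1}"
  define R :: "'a mod_ring set" where "R = of_nat ` A"
  have rep_c: "rep c = m - 2" unfolding c_def using m by (intro rep_of_nat) simp
  then have c0: "c \<noteq> 0" using m by auto
  have x: "positive_point x"
    using c0 by (auto simp: positive_point_def kunz_cone_def x_def)
  have tight: "tight x a b \<longleftrightarrow> a \<noteq> 0 \<and> b \<noteq> 0 \<and> a + b = c" for a b
    using c0 by (auto simp: tight_def x_def)
  have decomps: "decomps x c = UNIV - {0, c}"
    by (auto simp: decomps_def tight)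
  \<comment> \<open>The residue \<open>m - 1\<close> is one of the two halves of \<open>c\<close>; it is the only one whose pair wraps around.\<close>
  have rep_diff: "rep (c - a) = (if rep a = m - 1 then m - 1 else m - 2 - rep a)" for a
  proof -
    have "rep (c - a + a) = m - 2" using rep_c by simp
    then show ?thesis
      using rep_less[of a] rep_less[of "c - a"] m unfolding rep_add by (auto split: if_splits)
  qed
  have A: "A \<subseteq> {..<CARD('a)}" using m by (auto simp: A_def)
  have R_iff: "a \<in> R \<longleftrightarrow> rep a \<in> A" for a
  proof
    assume "a \<in> R"
    then obtain i where "a = of_nat i" "i \<in> A" by (auto simp: R_def)
    then show "rep a \<in> A" using A rep_of_nat[of i, where 'a='a] by auto
  next
    assume "rep a \<in> A"
    then have "of_nat (rep a) \<in> R" unfolding R_def by (rule imageI)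
    then show "a \<in> R" by simp
  qed
  have card_R: "card R = m div 2"
    unfolding R_def card_of_nat_image[OF A] unfolding A_def
    using m by (subst card_insert_disjoint) auto
  have dec: "decomposable x \<subseteq> {c}"
    by (auto simp: decomposable_iff tight)
  have R_decomps: "R \<subseteq> decomps x c"
    using m rep_c by (auto simp: R_iff decomps A_def)
  have "dim (tight_space x) = CARD('a) - 1 - card R"
  proof (rule dim_tight_space_single[OF dec R_decomps])
    show "a \<in> R \<or> c - a \<in> R" if "a \<in> decomps x c" for a
    proof -
      have "1 \<le> rep a" "rep a \<noteq> m - 2"
        using that by (auto simp: decomps rep_inject Suc_le_eq simp flip: rep_c)
      then show ?thesis
        using rep_less[of a] m unfolding R_iff rep_diff by (auto simp: A_def)
    qed
    show "c - a \<notin> R \<or> c - a = a" if "a \<in> R" for a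
      using that m unfolding R_iff rep_diff rep_inject[symmetric] by (auto simp: A_def)
  qed
  then have "dim (tight_space x) = m div 2 - 1"
    unfolding card_R m(1)[symmetric] using m(3) by (auto elim: evenE)
  moreover have "decomposable x = {c}"
  proof -
    have "m - 1 \<in> A" by (simp add: A_def)
    then have "of_nat (m - 1) \<in> R" unfolding R_def by (rule imageI)
    then show ?thesis using dec R_decomps mem_decomposable by blast
  qed
  then have "embdim (tight_face x) = m - 2"
    using tight_face_realizes(3)[OF x] m by simp
  ultimately show ?thesis
    using tight_face_realizes[OF x] by metis
qed

section \<open>Faces with at least two decomposable residues\<close>

text \<open>
  Let \<open>C i\<close> be \<open>i / q\<close> rounded up, the least number of summands from \<open>1, ..., q\<close> that add up to
  \<open>i\<close>. On the residues \<open>1, ..., n\<close> the Kunz coordinates \<open>2 * C i\<close> make \<open>q + 1, ..., n\<close> the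
  decomposable residues. Since both \<open>q + 1\<close> and \<open>q + 2\<close> are decomposable, the tight equations force
  the coordinates \<open>1, ..., q\<close> into an arithmetic progression, which leaves the two-parameter family
  \<open>u * C i + v * i\<close>. The residues above \<open>n\<close> get the odd coordinate \<open>2 * C n - 1\<close>: too small for a
  tight sum, and too large for a summand of one. Each of them contributes an atom and a free
  parameter.
\<close>
lemma exists_face_two_parameters:
  fixes q n :: nat
  assumes m: "m = CARD('a::nontriv)" and q: "2 \<le> q" "q + 2 \<le> n" "n \<le> m - 1"
  shows "\<exists>F :: (real ^ 'a mod_ring) set. kunz_face F \<and> \<not> degenerate F \<and> apery F \<and>
    embdim F = m - 1 - (n - q) \<and> dim F = 2 + (m - 1 - n)"
proof -
  define C where "C i = (i + q - 1) div q" for i :: nat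
  have C_le: "C i \<le> t \<longleftrightarrow> i \<le> t * q" for i t
  proof -
    have "C i < Suc t \<longleftrightarrow> i + q - 1 < Suc t * q"
      unfolding C_def using q by (intro div_less_iff_less_mult) simp
    then show ?thesis using q by auto
  qed
  have C_mono: "C i \<le> C j" if "i \<le> j" for i j
    using C_le[of i "C j"] C_le[of j "C j"] that by linarith
  have C_add: "C (i + j) \<le> C i + C j" for i j
    using C_le[of i "C i"] C_le[of j "C j"] C_le[of "i + j" "C i + C j"]
    by (simp add: add_mult_distrib)
  have C_0: "C 0 = 0" using C_le[of 0 0] by simp
  have C_pos: "1 \<le> C i" if "0 < i" for i using C_le[of i 0] that by simp
  have C_1: "C i = 1" if "0 < i" "i \<le> q" for i using C_le[of i 1] C_pos[of i] that by simp
  have C_q: "C (i + q) = C i + 1" for i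
  proof -
    have eq: "i + q + q - 1 = (i + q - 1) + q" using q by simp
    show ?thesis unfolding C_def eq by (rule div_add_self2) (use q in simp)
  qed
  have C_n: "2 \<le> C n" using C_le[of n 1] q by simp
  define k where "k i = (if i \<le> n then 2 * C i else 2 * C n - 1)" for i
  define x :: "real ^ 'a mod_ring" where "x = kunz_point k"
  have k: "kunz_coordinates CARD('a) k"
    unfolding kunz_coordinates_def
  proof (intro conjI allI impI)
    show "k 0 = 0" by (simp add: k_def C_0)
  next
    fix i j :: nat assume ij: "0 < i" "0 < j"
    have "C n \<le> C i + C j" if "n < i + j"
      using C_mono[of n "i + j"] C_add[of i j] that by simp
    then show "k (i + j) \<le> k i + k j"
      using C_add[of i j] C_pos[OF ij(1)] C_pos[OF ij(2)] by (fastforce simp: k_def)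
  next
    fix i j assume "i < CARD('a)" "j < CARD('a)" "CARD('a) < i + j"
    then have "i + j - CARD('a) \<le> i" "i + j - CARD('a) \<le> j" by auto
    then show "k (i + j - CARD('a)) \<le> k i + k j"
      using C_mono[of "i + j - CARD('a)" i] C_mono[of "i + j - CARD('a)" j]
        C_mono[of "i + j - CARD('a)" n] C_n
      by (auto simp: k_def)
  qed
  have tight: "tight x a b \<longleftrightarrow>
      a \<noteq> 0 \<and> b \<noteq> 0 \<and> rep a + rep b \<le> n \<and> C (rep a + rep b) = C (rep a) + C (rep b)" for a b
  proof (cases "a = 0 \<or> b = 0")
    case False
    then have pos: "C (rep a) \<ge> 1" "C (rep b) \<ge> 1"
      using C_pos[of "rep a"] C_pos[of "rep b"] by simp_all
    have "k (rep a + rep b) < k (rep a) + k (rep b)" if "n < rep a + rep b"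
    proof -
      have "C n \<le> C (rep a) + C (rep b)"
        using C_mono[of n "rep a + rep b"] C_add[of "rep a" "rep b"] that by simp
      then show ?thesis
        using that pos C_n by (cases "rep a \<le> n"; cases "rep b \<le> n") (simp_all add: k_def)
    qed
    moreover have "k (rep a + rep b) = k (rep a) + k (rep b) \<longleftrightarrow>
        C (rep a + rep b) = C (rep a) + C (rep b)" if "rep a + rep b \<le> n"
      using that by (auto simp: k_def)
    moreover have "rep a + rep b < CARD('a)" if "rep a + rep b \<le> n"
      using that q m by linarith
    ultimately have "rep a + rep b < CARD('a) \<and> k (rep a + rep b) = k (rep a) + k (rep b) \<longleftrightarrow>
        rep a + rep b \<le> n \<and> C (rep a + rep b) = C (rep a) + C (rep b)"
      by (cases "rep a + rep b \<le> n") auto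
    then show ?thesis unfolding tight_kunz_point[OF k x_def] by blast
  qed (auto simp: tight_kunz_point[OF k x_def])
  have tight_rep: "rep (a + b) = rep a + rep b" if "tight x a b" for a b
  proof -
    have "rep a + rep b \<le> n" using that by (simp add: tight)
    then have "rep a + rep b < CARD('a)" using q m by linarith
    then show ?thesis by (simp add: rep_add)
  qed
  have "decomposable x = of_nat ` {q<..n}"
  proof (rule Set.set_eqI, rule iffI)
    fix c assume "c \<in> decomposable x"
    then obtain a b where ab: "tight x a b" "c = a + b" by (auto simp: decomposable_iff)
    then have "C (rep c) = C (rep a) + C (rep b)" "rep c \<le> n" "a \<noteq> 0" "b \<noteq> 0"
      using tight_rep[OF ab(1)] by (auto simp: tight)
    then have "2 \<le> C (rep c)" using C_pos[of "rep a"] C_pos[of "rep b"] by simp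
    then have "q < rep c" using C_le[of "rep c" 1] by simp
    then have "of_nat (rep c) \<in> (of_nat ` {q<..n} :: 'a mod_ring set)"
      using \<open>rep c \<le> n\<close> by (intro imageI) simp
    then show "c \<in> of_nat ` {q<..n}" by simp
  next
    fix c :: "'a mod_ring" assume "c \<in> of_nat ` {q<..n}"
    then obtain i where i: "c = of_nat i" "q < i" "i \<le> n" by auto
    define a b :: "'a mod_ring" where "a = of_nat (i - q)" and "b = of_nat q"
    have "i - q < CARD('a)" "q < CARD('a)" using i q m by linarith+
    then have reps: "rep a = i - q" "rep b = q"
      unfolding a_def b_def by (auto intro: rep_of_nat simp del: of_nat_diff)
    have "C i = C (i - q) + C q" using C_q[of "i - q"] C_1[of q] i q by simp
    moreover have "a \<noteq> 0" "b \<noteq> 0" using reps i q by auto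
    ultimately have "tight x a b"
      using i q unfolding tight reps by simp
    moreover have "a + b = c"
      unfolding a_def b_def i(1) of_nat_add[symmetric] using i by simp
    ultimately show "c \<in> decomposable x" unfolding decomposable_iff by blast
  qed
  moreover have "card (of_nat ` {q<..n} :: 'a mod_ring set) = n - q"
    using q m by (subst card_of_nat_image) auto
  ultimately have card: "card (decomposable x) = n - q" by simp
  \<comment> \<open>The coordinates in \<open>B\<close> are independent parameters of the tight space.\<close>
  define B where "B = {1, 2} \<union> {n<..<m}"
  have B: "B \<subseteq> {..<CARD('a)}" using q m by (auto simp: B_def)
  have card_B: "card (of_nat ` B :: 'a mod_ring set) = 2 + (m - 1 - n)"
    unfolding card_of_nat_image[OF B] unfolding B_def
    using q by (subst card_Un_disjoint) auto
  have "dim (tight_space x) \<le> card (of_nat ` B :: 'a mod_ring set)"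
  proof (rule dim_le_card_coordinates[OF subspace_tight_space])
    fix y assume y: "y \<in> tight_space x" and zero: "\<forall>b\<in>of_nat ` B. y $ b = 0"
    define Y where "Y i = y $ of_nat i" for i :: nat
    have Y_B: "Y i = 0" if "i \<in> B" for i using zero that by (simp add: Y_def)
    have Y_add: "Y (i + j) = Y i + Y j"
      if "0 < i" "0 < j" "i + j \<le> n" "C (i + j) = C i + C j" for i j
    proof -
      have "i < CARD('a)" "j < CARD('a)" using that q m by linarith+
      then have reps: "rep (of_nat i :: 'a mod_ring) = i" "rep (of_nat j :: 'a mod_ring) = j"
        by (auto intro: rep_of_nat)
      then have "of_nat i \<noteq> (0 :: 'a mod_ring)" "of_nat j \<noteq> (0 :: 'a mod_ring)"
        using that(1,2) by (metis less_irrefl rep_0)+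
      then have "tight x (of_nat i) (of_nat j)"
        using that unfolding tight reps by blast
      then show ?thesis using y by (simp add: tight_space_def Y_def)
    qed
    have C_q1: "C (q + 1) = 2" "C (q + 2) = 2"
      using C_q[of 1] C_q[of 2] C_1[of 1] C_1[of 2] q by (simp_all add: add.commute)
    have step: "Y (Suc i) = Y i + Y (q + 2) - Y (q + 1)" if "0 < i" "i < q" for i
    proof -
      have "Y (i + (q + 1 - i)) = Y i + Y (q + 1 - i)"
        using that q C_q1 by (intro Y_add) (simp_all add: C_1)
      moreover have "Y (Suc i + (q + 1 - i)) = Y (Suc i) + Y (q + 1 - i)"
        using that q C_q1 by (intro Y_add) (simp_all add: C_1)
      ultimately show ?thesis using that by simp
    qed
    have "Y 1 = 0" "Y 2 = 0" by (auto intro!: Y_B simp: B_def)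
    then have "Y (q + 2) = Y (q + 1)" using step[of 1] q by (simp add: numeral_2_eq_2)
    then have step': "Y (Suc i) = Y i" if "0 < i" "i < q" for i using step that by simp
    have low: "Y i = 0" if "0 < i" "i \<le> q" for i
      using that
    proof (induction i)
      case (Suc i)
      then show ?case using \<open>Y 1 = 0\<close> step'[of i] by (cases "i = 0") auto
    qed simp
    have core: "Y i = 0" if "0 < i" "i \<le> n" for i
      using that
    proof (induction i rule: less_induct)
      case (less i)
      show ?case
      proof (cases "i \<le> q")
        case False
        have "Y ((i - q) + q) = Y (i - q) + Y q"
          using False less.prems q C_q[of "i - q"] C_1[of q] by (intro Y_add) simp_all
        then show ?thesis using False less.IH[of "i - q"] less.prems low[of q] q by simp
      qed (use low less.prems in auto)
    qed
    have "y $ a = 0" for a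
    proof (cases "a = 0")
      case True
      then show ?thesis using y by (simp add: tight_space_def)
    next
      case False
      then have "Y (rep a) = 0"
        using core[of "rep a"] Y_B[of "rep a"] rep_less[of a] m by (cases "rep a \<le> n") (auto simp: B_def)
      then show ?thesis by (simp add: Y_def)
    qed
    then show "y = 0" by (simp add: vec_eq_iff)
  qed
  moreover have "card (of_nat ` B :: 'a mod_ring set) \<le> dim (tight_space x)"
  proof (rule card_coordinates_le_dim)
    \<comment> \<open>The members \<open>2 * C i - i\<close> and \<open>i - C i\<close> of the two-parameter family have the values 1, 0 and
      0, 1 at the residues 1 and 2.\<close>
    define v :: "'a mod_ring \<Rightarrow> real ^ 'a mod_ring" where "v b =
      (if rep b = 1 then \<chi> i. if rep i \<le> n then 2 * real (C (rep i)) - real (rep i) else 0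
       else if rep b = 2 then \<chi> i. if rep i \<le> n then real (rep i) - real (C (rep i)) else 0
       else axis b 1)" for b
    show "v b \<in> tight_space x" if "b \<in> of_nat ` B" for b
    proof (rule tight_spaceI)
      have b: "rep b \<in> B" using that B rep_of_nat[where 'a='a] by auto
      then show "v b $ 0 = 0" by (auto simp: v_def C_0 axis_def B_def)
      fix a a' assume t: "tight x a a'"
      then have "rep (a + a') = rep a + rep a'" "rep a + rep a' \<le> n"
        "real (C (rep a + rep a')) = real (C (rep a)) + real (C (rep a'))"
        by (simp_all add: tight_rep tight)
      then show "v b $ a + v b $ a' = v b $ (a + a')"
        using b by (auto simp: v_def axis_def B_def)
    qed
    show "v b $ b' = (if b' = b then 1 else 0)" if "b \<in> of_nat ` B" "b' \<in> of_nat ` B" for b b'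
    proof -
      have "rep b \<in> B" "rep b' \<in> B" using that B rep_of_nat[where 'a='a] by auto
      then show ?thesis
        using q C_1[of 1] C_1[of 2] rep_inject[of b' b] by (auto simp: v_def axis_def B_def)
    qed
  qed
  ultimately have "dim (tight_space x) = 2 + (m - 1 - n)" using card_B by simp
  then show ?thesis
    using tight_face_realizes[OF positive_kunz_point[OF k x_def]] apery_kunz_point[OF k x_def]
      card m by metis
qed

section \<open>Faces without Apery points\<close>

lemma apery_point_inject:
  assumes "apery_point z" "z $ a = z $ b"
  shows "a = b"
proof -
  have "\<exists>k::int. z $ i = of_int k \<and> (of_int k :: 'a mod_ring) = i" for i
    using assms(1) by (cases "i = 0") (auto simp: apery_point_def intro: exI[of _ 0])
  then show ?thesis using assms(2) by (metis of_int_eq_iff)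
qed

lemma card_decomps_le:
  fixes z :: "real ^ 'a::nontriv mod_ring"
  assumes "c \<noteq> 0"
  shows "card (decomps z c) \<le> CARD('a) - 2"
proof -
  have "decomps z c \<subseteq> UNIV - {0, c}" by (auto simp: mem_decomps_iff)
  then have "card (decomps z c) \<le> card (UNIV - {0, c})" by (intro card_mono) simp_all
  also have "\<dots> = CARD('a) - 2" using assms by (simp add: card_Diff_subset)
  finally show ?thesis .
qed

text \<open>
  A residue \<^term>\<open>a\<close> with \<open>a + a = c\<close> in a tight way has the coordinate \<open>z c / 2\<close>, and an Apery point
  has pairwise distinct coordinates.
\<close>

lemma card_fixed_decomps_le_1:
  assumes "apery_point z"
  shows "card {a \<in> decomps z c. c - a = a} \<le> 1"
proof -
  have "a = b" if "a \<in> decomps z c" "c - a = a" "b \<in> decomps z c" "c - b = b" for a b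
  proof (rule apery_point_inject[OF assms])
    show "z $ a = z $ b" using that by (simp add: mem_decomps_iff)
  qed
  then show ?thesis unfolding card_le_Suc0_iff_eq[OF finite] One_nat_def by blast
qed

text \<open>
  The \<open>m - 2\<close> residues other than 0 and \<open>c\<close> with at most one self-paired term give at most
  \<open>(m - 1) / 2\<close> equations; evenness of \<open>m\<close> sharpens this to \<open>(m - 2) / 2\<close>.
\<close>
lemma dim_single_apery_ge:
  fixes z :: "real ^ 'a::nontriv mod_ring"
  assumes z: "apery_point z" and one: "card (decomposable z) = 1" and m: "even CARD('a)"
  shows "CARD('a) \<le> 2 * dim (tight_space z)"
proof -
  obtain c where c: "decomposable z = {c}" using one by (rule card_1_singletonE)
  then have "c \<noteq> 0" by (auto simp: decomposable_def mem_decomps_iff)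
  then have "card (decomps z c) \<le> CARD('a) - 2" by (rule card_decomps_le)
  moreover have "2 * CARD('a) \<le> 2 * dim (tight_space z) + 2 +
      (card (decomps z c) + card {a \<in> decomps z c. c - a = a})"
    using codim_tight_space_le[of z] by (simp add: c)
  moreover have "CARD('a) \<ge> 2" using nontriv[where 'a='a] by simp
  ultimately have "CARD('a) \<le> 2 * dim (tight_space z) + 1"
    using card_fixed_decomps_le_1[OF z, of c] by linarith
  then show ?thesis using m by (auto elim!: evenE)
qed

text \<open>
  An Apery point on a ray with exactly two decomposable residues is impossible. A ray needs
  \<open>m - 2\<close> independent tight equations; counting them by their terms, with at most one self-paired
  term for each of the two sums \<open>c1\<close> and \<open>c2\<close>, gives the last assumption below: all but at most four of
  the \<open>2 * (m - 1)\<close> possible terms occur. Three of the missing terms are known, namely \<open>c1\<close> and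
  \<open>c2\<close> for the sum \<open>c1\<close> and \<open>c2\<close> for the sum \<open>c2\<close>. Hence almost every residue can be translated
  by \<open>\<delta> = c2 - c1\<close> with its coordinate growing by \<open>t > 0\<close>. This cannot happen on a nonempty set of
  residues that is closed under the translation; depending on which of \<open>c1\<close>, \<open>\<delta>\<close> and \<open>c1 - \<delta>\<close>
  occur as terms, such a set exists or there are too many missing terms, unless \<open>c1 = 2 * \<delta>\<close> and
  \<open>c2 = 3 * \<delta>\<close> with coordinates \<open>2 * t\<close> and \<open>3 * t\<close>. In this last case all other coordinates are
  below \<open>3 * t\<close>, so the remaining residues, of which there are at least three, form one progression
  of length three. Reflecting its first member in \<open>c1\<close> shows that this member is \<open>\<delta>\<close> or that
  \<open>\<delta>\<close> is decomposable, and both are impossible.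
\<close>
locale apery_ray =
  fixes z :: "real ^ 'a::nontriv mod_ring" and c1 c2 :: "'a mod_ring"
  assumes pos: "positive_point z" and apery: "apery_point z"
    and dec: "decomposable z = {c1, c2}" and less: "z $ c1 < z $ c2"
    and m: "CARD('a) \<ge> 7" and count: "2 * CARD('a) \<le> card (decomps z c1) + card (decomps z c2) + 6"
begin

definition "parts1 = decomps z c1"
definition "parts2 = decomps z c2"
definition "missing1 = UNIV - {0} - parts1"
definition "missing2 = UNIV - {0} - parts2"
definition "\<delta> = c2 - c1"
definition "t = z $ c2 - z $ c1"

lemma z_pos: "a \<noteq> 0 \<Longrightarrow> z $ a > 0"
  using pos by (simp add: positive_point_def)

lemma targets: "c1 \<noteq> 0" "c2 \<noteq> 0" "c1 \<noteq> c2"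
proof -
  have "c1 \<in> decomposable z" "c2 \<in> decomposable z" using dec by auto
  then show "c1 \<noteq> 0" "c2 \<noteq> 0" by (auto simp: decomposable_def mem_decomps_iff)
  show "c1 \<noteq> c2" using less by auto
qed

lemma \<delta>_nz: "\<delta> \<noteq> 0" and t_pos: "t > 0" and c2_eq: "c2 = c1 + \<delta>" and z_c2: "z $ c2 = z $ c1 + t"
  using targets less by (auto simp: \<delta>_def t_def)

lemma tight_sum: "a \<noteq> 0 \<Longrightarrow> b \<noteq> 0 \<Longrightarrow> a + b \<noteq> 0 \<Longrightarrow> z $ a + z $ b = z $ (a + b) \<Longrightarrow> a + b = c1 \<or> a + b = c2"
  using dec unfolding set_eq_iff decomposable_iff tight_def by blast

lemma parts1_iff: "a \<in> parts1 \<longleftrightarrow> a \<noteq> 0 \<and> a \<noteq> c1 \<and> z $ a + z $ (c1 - a) = z $ c1"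
  using targets by (simp add: parts1_def mem_decomps_iff)

lemma parts2_iff: "a \<in> parts2 \<longleftrightarrow> a \<noteq> 0 \<and> a \<noteq> c2 \<and> z $ a + z $ (c2 - a) = z $ c2"
  using targets by (simp add: parts2_def mem_decomps_iff)

lemma parts1_diff: "a \<in> parts1 \<Longrightarrow> c1 - a \<in> parts1"
  by (simp add: parts1_def diff_mem_decomps)

lemma parts1_less: "a \<in> parts1 \<Longrightarrow> z $ a < z $ c1"
  using z_pos[of "c1 - a"] by (auto simp: parts1_iff)

lemma parts2_less: "a \<in> parts2 \<Longrightarrow> z $ a < z $ c2"
  using z_pos[of "c2 - a"] by (auto simp: parts2_iff)

lemma not_mem: "c1 \<notin> parts1" "c2 \<notin> parts1" "c2 \<notin> parts2"
  using parts1_less[of c2] less by (auto simp: parts1_iff parts2_iff)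

lemma missing_count: "card missing1 + card missing2 \<le> 4"
proof -
  have "parts1 \<subseteq> UNIV - {0}" "parts2 \<subseteq> UNIV - {0}" by (auto simp: parts1_iff parts2_iff)
  then have "card missing1 = CARD('a) - 1 - card parts1" "card missing2 = CARD('a) - 1 - card parts2"
    by (simp_all add: missing1_def missing2_def card_Diff_subset)
  moreover have "card parts1 \<le> CARD('a) - 2" "card parts2 \<le> CARD('a) - 2"
    unfolding parts1_def parts2_def using targets by (simp_all add: card_decomps_le)
  ultimately show ?thesis using count m unfolding parts1_def parts2_def by linarith
qed

lemma missing_known: "c1 \<in> missing1" "c2 \<in> missing1" "c2 \<in> missing2"
  using not_mem targets by (auto simp: missing1_def missing2_def)

text \<open>
  Once four missing terms are known, all others are present.
\<close>
lemma missing_eqI: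
  assumes "X1 \<subseteq> missing1" "X2 \<subseteq> missing2" "card X1 + card X2 = 4"
  shows "missing1 = X1 \<and> missing2 = X2"
proof -
  have "card X1 \<le> card missing1" "card X2 \<le> card missing2" using assms by (simp_all add: card_mono)
  then have "card X1 = card missing1" "card X2 = card missing2" using assms(3) missing_count by linarith+
  then show ?thesis using assms by (metis card_subset_eq finite)
qed

lemma mem_parts1: "a \<noteq> 0 \<Longrightarrow> a \<notin> missing1 \<Longrightarrow> a \<in> parts1" and mem_parts2: "a \<noteq> 0 \<Longrightarrow> a \<notin> missing2 \<Longrightarrow> a \<in> parts2"
  by (auto simp: missing1_def missing2_def)

text \<open>
  Reflecting first in \<^term>\<open>c1\<close> and then in \<^term>\<open>c2\<close> translates the residue by \<^term>\<open>\<delta>\<close> and its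
  coordinate by the positive number \<^term>\<open>t\<close>.
\<close>

lemma shift:
  assumes "a \<in> parts1" "c1 - a \<in> parts2"
  shows "a + \<delta> \<in> parts2" "z $ (a + \<delta>) = z $ a + t"
proof -
  have eq: "c2 - (c1 - a) = a + \<delta>" by (simp add: \<delta>_def)
  have "c2 - (c1 - a) \<in> parts2" using assms(2) by (simp add: parts2_def diff_mem_decomps)
  then show "a + \<delta> \<in> parts2" unfolding eq .
  have "z $ (c1 - a) + z $ (a + \<delta>) = z $ c2" using assms(2) by (simp add: parts2_iff eq)
  moreover have "z $ a + z $ (c1 - a) = z $ c1" using assms(1) by (simp add: parts1_iff)
  ultimately show "z $ (a + \<delta>) = z $ a + t" by (simp add: t_def)
qed

lemma ex_max_coordinate: "Q \<noteq> {} \<Longrightarrow> \<exists>g\<in>Q. \<forall>a\<in>Q. z $ a \<le> z $ g"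
proof -
  assume "Q \<noteq> {}"
  then have "Max ((\<lambda>a. z $ a) ` Q) \<in> (\<lambda>a. z $ a) ` Q" by (intro Max_in) simp_all
  then obtain g where "g \<in> Q" "z $ g = Max ((\<lambda>a. z $ a) ` Q)" by auto
  then show ?thesis by (metis Max_ge finite finite_imageI imageI)
qed

lemma no_invariant_set:
  assumes "Q \<noteq> {}" "\<And>a. a \<in> Q \<Longrightarrow> a \<in> parts1 \<and> c1 - a \<in> parts2 \<and> a + \<delta> \<in> Q"
  shows False
proof -
  obtain g where g: "g \<in> Q" "\<And>a. a \<in> Q \<Longrightarrow> z $ a \<le> z $ g"
    using ex_max_coordinate[OF assms(1)] by blast
  have "z $ (g + \<delta>) \<le> z $ g" using g(2) assms(2)[OF g(1)] by simp
  then show False using shift(2)[of g] assms(2)[OF g(1)] t_pos by simp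
qed

lemma card_complement: "card (- K) = CARD('a) - card K" for K :: "'a mod_ring set"
  by (simp add: Compl_eq_Diff_UNIV card_Diff_subset)

lemma complement_nonempty: "card K < CARD('a) \<Longrightarrow> - K \<noteq> {}" for K :: "'a mod_ring set"
  using card_complement[of K] by force

text \<open>
  Otherwise the four missing terms are \<open>c1\<close> and \<open>c2\<close> for both sums, and all residues but these two
  form an invariant set.
\<close>
lemma c1_mem_parts2: "c1 \<in> parts2"
proof (rule ccontr)
  assume c1: "c1 \<notin> parts2"
  have "missing1 = {c1, c2} \<and> missing2 = {c1, c2}"
    using c1 missing_known targets by (intro missing_eqI) (simp_all add: missing2_def)
  then have N: "missing1 = {c1, c2}" "missing2 = {c1, c2}" by blast+
  show False
  proof (rule no_invariant_set[of "- {0, c1, c2}"])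
    show "- {0, c1, c2} \<noteq> {}"
      using m by (intro complement_nonempty) (simp add: card_insert_if)
    fix a assume a: "a \<in> - {0, c1, c2}"
    then have a1: "a \<in> parts1" by (intro mem_parts1) (auto simp: N)
    then have "c1 - a \<in> parts1" by (rule parts1_diff)
    then have "c1 - a \<in> parts2" using not_mem by (intro mem_parts2) (auto simp: N parts1_iff)
    then have "a + \<delta> \<in> parts2" using shift a1 by blast
    then have "a + \<delta> \<in> - {0, c1, c2}" using c1 by (auto simp: parts2_iff)
    then show "a \<in> parts1 \<and> c1 - a \<in> parts2 \<and> a + \<delta> \<in> - {0, c1, c2}"
      using a1 \<open>c1 - a \<in> parts2\<close> by blast
  qed
qed

lemma z_\<delta>: "\<delta> \<in> parts2" "z $ \<delta> = t"
proof -
  show "\<delta> \<in> parts2" using c1_mem_parts2 by (simp add: \<delta>_def parts2_def diff_mem_decomps)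
  have "z $ c1 + z $ \<delta> = z $ c2" using c1_mem_parts2 by (simp add: parts2_iff \<delta>_def)
  then show "z $ \<delta> = t" by (simp add: t_def)
qed

text \<open>
  If \<open>c2 = c1 + c1\<close>, translation by \<^term>\<open>\<delta>\<close> takes a coordinate beyond \<open>z $ c1 = t\<close>, so each
  translated residue is missing for the sum \<open>c1\<close>. Besides \<open>c1\<close> and \<open>c2\<close> at most one is, but three residues
  occur for both sums and give rise to one each.
\<close>
lemma \<delta>_neq_c1: "\<delta> \<noteq> c1"
proof
  assume \<delta>: "\<delta> = c1"
  have "card (missing1 \<union> missing2) \<le> 3"
  proof -
    have "card (missing1 \<inter> missing2) \<ge> card {c2}" using missing_known by (intro card_mono) auto
    then show ?thesis using missing_count card_Un_Int[of missing1 missing2] by simp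
  qed
  then have "card (insert 0 (missing1 \<union> missing2)) \<le> 4" by (simp add: card_insert_if)
  then have "CARD('a) - 4 \<le> card (- insert 0 (missing1 \<union> missing2))"
    by (simp add: card_complement)
  then have "3 \<le> card (- insert 0 (missing1 \<union> missing2))" using m by linarith
  moreover have "- insert 0 (missing1 \<union> missing2) \<subseteq> parts1 \<inter> parts2" by (auto simp: missing1_def missing2_def)
  then have "card (- insert 0 (missing1 \<union> missing2)) \<le> card (parts1 \<inter> parts2)" by (simp add: card_mono)
  ultimately have "\<not> card (parts1 \<inter> parts2) \<le> Suc 0" by linarith
  then obtain b b' where b: "b \<in> parts1" "b \<in> parts2" "b' \<in> parts1" "b' \<in> parts2" "b \<noteq> b'"
    unfolding card_le_Suc0_iff_eq[OF finite] by blast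
  have new: "c1 - a + c1 \<in> missing1 - {c1, c2}" if "a \<in> parts1" "a \<in> parts2" for a
  proof -
    have a: "c1 - a \<in> parts1" "c1 - (c1 - a) \<in> parts2" using that parts1_diff by auto
    have "z $ (c1 - a + c1) > z $ c1"
      using shift(2)[OF a] z_pos[of "c1 - a"] a z_\<delta>(2) by (simp add: \<delta> parts1_iff)
    then have "c1 - a + c1 \<notin> parts1" using parts1_less by fastforce
    moreover have "c1 - a + c1 \<noteq> 0" using shift(1)[OF a] by (simp add: \<delta> parts2_iff)
    moreover have "c1 - a + c1 \<noteq> c1" using a by (auto simp: parts1_iff)
    moreover have "c1 - a + c1 \<noteq> c2" using shift(1)[OF a] not_mem by (auto simp: \<delta>)
    ultimately show ?thesis by (simp add: missing1_def)
  qed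
  have "card {c1, c2, c1 - b + c1, c1 - b' + c1} \<le> card missing1"
    using new[of b] new[of b'] b missing_known by (intro card_mono) auto
  moreover have "card {c1, c2, c1 - b + c1, c1 - b' + c1} = 4"
    using new[of b] new[of b'] b targets by (auto simp: card_insert_if)
  moreover have "1 \<le> card missing2" using missing_known by (simp add: card_gt_0_iff Suc_le_eq) auto
  ultimately show False using missing_count by linarith
qed

lemma \<delta>_neq_c2: "\<delta> \<noteq> c2"
  using targets by (simp add: \<delta>_def)

text \<open>
  Otherwise \<^term>\<open>\<delta>\<close> is the fourth missing term, and the residues other than \<open>c1\<close>, \<open>c2\<close> and
  \<^term>\<open>\<delta>\<close> form an invariant set.
\<close>
lemma \<delta>_mem_parts1: "\<delta> \<in> parts1"
proof (rule ccontr)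
  assume \<delta>: "\<delta> \<notin> parts1"
  have "\<delta> \<in> missing1" using \<delta> \<delta>_nz by (simp add: missing1_def)
  then have "missing1 = {c1, c2, \<delta>} \<and> missing2 = {c2}"
    using \<delta>_neq_c1 \<delta>_neq_c2 missing_known targets by (intro missing_eqI) auto
  then have N: "missing1 = {c1, c2, \<delta>}" "missing2 = {c2}" by blast+
  let ?Q = "- {0, c1, c2, \<delta>}"
  show False
  proof (rule no_invariant_set[of ?Q])
    show "?Q \<noteq> {}"
      using m by (intro complement_nonempty) (simp add: card_insert_if)
    fix a assume a: "a \<in> ?Q"
    then have a1: "a \<in> parts1" by (intro mem_parts1) (auto simp: N)
    then have r: "c1 - a \<in> parts1" by (rule parts1_diff)
    then have "c1 - a \<in> parts2" using not_mem by (intro mem_parts2) (auto simp: N parts1_iff)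
    then have "a + \<delta> \<in> parts2" using shift a1 by blast
    moreover have "a + \<delta> \<noteq> c1" using r \<delta> by (metis add_diff_cancel_left')
    ultimately have "a + \<delta> \<in> ?Q" using a by (auto simp: parts2_iff)
    then show "a \<in> parts1 \<and> c1 - a \<in> parts2 \<and> a + \<delta> \<in> ?Q"
      using a1 \<open>c1 - a \<in> parts2\<close> by blast
  qed
qed

text \<open>
  Otherwise \<open>c1 - \<delta>\<close> is the fourth missing term: if it occurred for the sum \<open>c2\<close>, then
  \<open>\<delta> + \<delta>\<close> would have the coordinate \<open>2 * t\<close> and be decomposable, hence be \<open>c1\<close> or \<open>c2\<close>.
\<close>
lemma c1_eq: "c1 = \<delta> + \<delta>"
proof (rule ccontr)
  assume ne: "c1 \<noteq> \<delta> + \<delta>"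
  have r: "c1 - \<delta> \<in> parts1" using \<delta>_mem_parts1 by (rule parts1_diff)
  have r2: "c1 - \<delta> \<notin> parts2"
  proof
    assume "c1 - \<delta> \<in> parts2"
    then have "\<delta> + \<delta> \<in> parts2" "z $ \<delta> + z $ \<delta> = z $ (\<delta> + \<delta>)"
      using shift[OF \<delta>_mem_parts1] z_\<delta> by simp_all
    then have "\<delta> + \<delta> = c1 \<or> \<delta> + \<delta> = c2"
      using \<delta>_nz by (intro tight_sum) (auto simp: parts2_iff)
    then show False using ne \<delta>_neq_c1 c2_eq by (metis add_right_cancel)
  qed
  have "c1 - \<delta> \<noteq> c2" using r not_mem by metis
  moreover have "c1 - \<delta> \<in> missing2" using r r2 by (simp add: missing2_def parts1_iff)
  ultimately have "missing1 = {c1, c2} \<and> missing2 = {c2, c1 - \<delta>}"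
    using missing_known targets by (intro missing_eqI) auto
  then have N: "missing1 = {c1, c2}" "missing2 = {c2, c1 - \<delta>}" by blast+
  let ?Q = "- {0, c1, c2, \<delta>, c1 - \<delta>}"
  show False
  proof (rule no_invariant_set[of ?Q])
    show "?Q \<noteq> {}"
      using m by (intro complement_nonempty) (simp add: card_insert_if)
    fix a assume a: "a \<in> ?Q"
    then have a1: "a \<in> parts1" by (intro mem_parts1) (auto simp: N)
    then have "c1 - a \<in> parts1" by (rule parts1_diff)
    then have "c1 - a \<noteq> 0" "c1 - a \<noteq> c2" using not_mem by (auto simp: parts1_iff)
    moreover have "c1 - a \<noteq> c1 - \<delta>" using a by simp
    ultimately have "c1 - a \<in> parts2" by (intro mem_parts2) (simp_all add: N)
    then have s: "a + \<delta> \<in> parts2" using shift a1 by blast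
    moreover have "a + \<delta> \<noteq> c1" using a by (auto simp: algebra_simps)
    moreover have "a + \<delta> \<noteq> c1 - \<delta>" using s r2 by metis
    ultimately have "a + \<delta> \<in> ?Q" using a by (auto simp: parts2_iff)
    then show "a \<in> parts1 \<and> c1 - a \<in> parts2 \<and> a + \<delta> \<in> ?Q"
      using a1 \<open>c1 - a \<in> parts2\<close> by blast
  qed
qed

lemma no_apery_ray: False
proof -
  have z_c: "z $ c1 = 2 * t" "z $ c2 = 3 * t"
  proof -
    have eq: "c1 - \<delta> = \<delta>" using c1_eq by (metis add_diff_cancel_right')
    have "z $ \<delta> + z $ (c1 - \<delta>) = z $ c1" using \<delta>_mem_parts1 by (simp add: parts1_iff)
    then show "z $ c1 = 2 * t" using z_\<delta>(2) unfolding eq by simp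
    then show "z $ c2 = 3 * t" by (simp add: z_c2)
  qed
  define Q where "Q = - {0, \<delta>, c1, c2}"
  have "card {0, \<delta>, c1, c2} \<le> 4" by (simp add: card_insert_if)
  then have card_Q: "3 \<le> card Q" using m by (simp add: Q_def card_complement)
  then have "Q \<noteq> {}" by auto
  from ex_max_coordinate[OF this]
  obtain g where g: "g \<in> Q" "\<And>a. a \<in> Q \<Longrightarrow> z $ a \<le> z $ g" by blast
  have reflect: "c1 - a \<in> Q" if "a \<in> Q" "a \<in> parts1" for a
  proof -
    have "c1 - a \<in> parts1" using that parts1_diff by blast
    moreover have "c1 - a \<noteq> \<delta>"
    proof
      assume "c1 - a = \<delta>"
      then have "\<delta> + a = \<delta> + \<delta>" using c1_eq by (metis diff_add_cancel)
      then show False using that(1) by (simp add: Q_def)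
    qed
    ultimately show ?thesis using not_mem by (auto simp: Q_def parts1_iff)
  qed
  have shift_Q: "a + \<delta> \<in> Q" if "a \<in> Q" "a \<in> parts1" "c1 - a \<in> parts2" for a
  proof -
    have "a + \<delta> \<noteq> c1"
    proof
      assume "a + \<delta> = c1"
      then have "a + \<delta> = \<delta> + \<delta>" using c1_eq by metis
      then show False using that(1) by (simp add: Q_def)
    qed
    then show ?thesis using shift(1)[OF that(2,3)] that by (auto simp: Q_def parts2_iff)
  qed
  have g_bad: "g \<notin> parts1 \<or> c1 - g \<notin> parts2"
  proof (rule ccontr)
    assume "\<not> (g \<notin> parts1 \<or> c1 - g \<notin> parts2)"
    then have "z $ (g + \<delta>) \<le> z $ g" "z $ (g + \<delta>) = z $ g + t"
      using shift_Q shift(2) g by blast+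
    then show False using t_pos by simp
  qed
  \<comment> \<open>Three missing terms lie outside \<open>Q\<close>, so the failure at \<open>g\<close> is the only one inside.\<close>
  have "(\<forall>a\<in>Q - {g}. a \<in> parts1 \<and> c1 - a \<in> parts2) \<and> z $ g < 3 * t"
  proof (cases "g \<in> parts1")
    case False
    have "g \<in> missing1" "g \<noteq> c1" "g \<noteq> c2" using False g(1) by (simp_all add: missing1_def Q_def)
    then have "missing1 = {c1, c2, g} \<and> missing2 = {c2}"
      using missing_known targets by (intro missing_eqI) auto
    then have N: "missing1 = {c1, c2, g}" "missing2 = {c2}" by blast+
    have "g \<in> parts2" using g(1) by (intro mem_parts2) (auto simp: N Q_def)
    then have "z $ g < 3 * t" using parts2_less z_c by simp
    moreover have "a \<in> parts1 \<and> c1 - a \<in> parts2" if "a \<in> Q - {g}" for a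
    proof -
      have "a \<in> parts1" using that by (intro mem_parts1) (auto simp: N Q_def)
      moreover from this have "c1 - a \<in> Q" using reflect that by blast
      then have "c1 - a \<in> parts2" by (intro mem_parts2) (auto simp: N Q_def)
      ultimately show ?thesis by blast
    qed
    ultimately show ?thesis by blast
  next
    case True
    then have r: "c1 - g \<notin> parts2" "c1 - g \<in> Q" using g_bad reflect g(1) by blast+
    have "c1 - g \<in> missing2" "c1 - g \<noteq> c2" using r by (simp_all add: missing2_def Q_def)
    then have "missing1 = {c1, c2} \<and> missing2 = {c2, c1 - g}"
      using missing_known targets by (intro missing_eqI) auto
    then have N: "missing1 = {c1, c2}" "missing2 = {c2, c1 - g}" by blast+
    have "z $ g < 3 * t" using parts1_less[OF True] z_c t_pos by simp
    moreover have "a \<in> parts1 \<and> c1 - a \<in> parts2" if "a \<in> Q - {g}" for a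
    proof -
      have "a \<in> parts1" using that by (intro mem_parts1) (auto simp: N Q_def)
      moreover from this have "c1 - a \<in> Q" using reflect that by blast
      moreover have "c1 - a \<noteq> c1 - g" using that by simp
      ultimately have "c1 - a \<in> parts2" by (intro mem_parts2) (auto simp: N Q_def)
      then show ?thesis using \<open>a \<in> parts1\<close> by blast
    qed
    ultimately show ?thesis by blast
  qed
  then have good: "\<And>a. a \<in> Q \<Longrightarrow> a \<noteq> g \<Longrightarrow> a \<in> parts1 \<and> c1 - a \<in> parts2" and z_g: "z $ g < 3 * t"
    by blast+
  have step: "a + \<delta> \<in> Q \<and> z $ (a + \<delta>) = z $ a + t" if "a \<in> Q" "a \<noteq> g" for a
    using good[OF that] shift_Q shift(2) that by blast
  have chain: "a = g \<or> a + \<delta> = g \<or> a + \<delta> + \<delta> = g" if "a \<in> Q" for a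
  proof (rule ccontr)
    assume ne: "\<not> (a = g \<or> a + \<delta> = g \<or> a + \<delta> + \<delta> = g)"
    then have s: "a + \<delta> \<in> Q" "z $ (a + \<delta>) = z $ a + t" using step[of a] that by auto
    then have s2: "a + \<delta> + \<delta> \<in> Q" "z $ (a + \<delta> + \<delta>) = z $ (a + \<delta>) + t"
      using step[of "a + \<delta>"] ne by auto
    then have "a + \<delta> + \<delta> + \<delta> \<in> Q" "z $ (a + \<delta> + \<delta> + \<delta>) = z $ (a + \<delta> + \<delta>) + t"
      using step[of "a + \<delta> + \<delta>"] ne by auto
    then have "z $ a + 3 * t \<le> z $ g" using g(2) s s2 by fastforce
    moreover have "z $ a > 0" using that by (intro z_pos) (auto simp: Q_def)
    ultimately show False using z_g by simp
  qed
  have Q: "Q = {g, g - \<delta>, g - \<delta> - \<delta>}"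
  proof (rule card_seteq)
    show "Q \<subseteq> {g, g - \<delta>, g - \<delta> - \<delta>}" using chain by (force simp: algebra_simps)
    have "card {g, g - \<delta>, g - \<delta> - \<delta>} \<le> 3" by (simp add: card_insert_if)
    then show "card {g, g - \<delta>, g - \<delta> - \<delta>} \<le> card Q" using card_Q by linarith
  qed simp
  have "card {g, g - \<delta>, g - \<delta> - \<delta>} = 3"
    using card_Q card_length[of "[g, g - \<delta>, g - \<delta> - \<delta>]"] unfolding Q by simp
  then have ne: "g - \<delta> - \<delta> \<noteq> g" "g - \<delta> \<noteq> g" by (auto simp: card_insert_if split: if_splits)
  define a where "a = g - \<delta> - \<delta>"
  have a: "a \<in> Q" "a \<noteq> g" "a + \<delta> \<in> Q" "a + \<delta> \<noteq> g" "a + \<delta> + \<delta> = g"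
    using Q ne by (auto simp: a_def)
  have z_a: "z $ (a + \<delta>) = z $ a + t" "z $ g = z $ a + 2 * t"
    using step[OF a(1,2)] step[OF a(3,4)] a(5) by simp_all
  have a0: "a \<noteq> 0" using a(1) by (auto simp: Q_def)
  have "g \<notin> parts1" using parts1_less[of g] z_a(2) z_c(1) z_pos[OF a0] by auto
  have a1: "a \<in> parts1" "c1 - a \<in> parts1" using good[OF a(1,2)] parts1_diff by auto
  then have "c1 - a \<in> Q" "c1 - a \<noteq> g" using reflect a(1) \<open>g \<notin> parts1\<close> by auto
  then have "c1 - a = a \<or> c1 - a = a + \<delta>" using Q by (auto simp: a_def)
  have sum: "z $ a + z $ (c1 - a) = 2 * t" using a1(1) z_c by (simp add: parts1_iff)
  from \<open>c1 - a = a \<or> c1 - a = a + \<delta>\<close> show False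
  proof
    assume "c1 - a = a"
    then have "z $ a = z $ \<delta>" using sum z_\<delta>(2) by simp
    then have "a = \<delta>" by (rule apery_point_inject[OF apery])
    then show False using a(1) by (simp add: Q_def)
  next
    assume eq: "c1 - a = a + \<delta>"
    then have "\<delta> + \<delta> = (a + \<delta>) + a" using c1_eq by (metis diff_add_cancel)
    then have "\<delta> + \<delta> = (a + a) + \<delta>" by (simp only: ac_simps)
    then have "a + a = \<delta>" by (metis add_right_cancel)
    moreover have "z $ a + z $ a = z $ \<delta>" using sum z_a(1) z_\<delta>(2) unfolding eq by simp
    ultimately have "\<delta> = c1 \<or> \<delta> = c2" using tight_sum[of a a] a0 \<delta>_nz by auto
    then show False using \<delta>_neq_c1 \<delta>_neq_c2 by blast
  qed
qed

end

lemma apery_face_point: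
  fixes F :: "(real ^ 'a::nontriv mod_ring) set"
  assumes F: "kunz_face F" "\<not> degenerate F" "apery F"
  obtains z :: "real ^ 'a mod_ring" where "positive_point z" "apery_point z" "dim (tight_space z) = dim F"
    "card (decomposable z) = CARD('a) - 1 - embdim F"
proof -
  obtain z :: "real ^ 'a mod_ring" where z: "z \<in> face_interior F" "apery_point z"
    using F(3) by (auto simp: apery_def)
  then have pos: "positive_point z" using positive_point_face_interior F by blast
  then have "dim (tight_space z) = dim F"
    using dim_tight_face face_eq_tight_face[OF F(1) z(1)] by metis
  moreover have "card (decomposable z) = CARD('a) - 1 - embdim F"
  proof -
    have "decomposable z \<subseteq> UNIV - {0}" by (auto simp: decomposable_iff tight_def)
    then have "card (decomposable z) \<le> CARD('a) - 1"
      using card_mono[of "UNIV - {0 :: 'a mod_ring}" "decomposable z"] by simp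
    then show ?thesis using embdim_eq[OF F(1,2) z(1)] by simp
  qed
  ultimately show thesis using that pos z(2) by blast
qed

lemma no_apery_face_dim_half:
  fixes F :: "(real ^ 'a::nontriv mod_ring) set"
  assumes F: "kunz_face F" "\<not> degenerate F" "apery F"
    and m: "even CARD('a)" and e: "embdim F + 2 = CARD('a)"
  shows "CARD('a) \<le> 2 * dim F"
proof -
  obtain z :: "real ^ 'a mod_ring" where z: "positive_point z" "apery_point z" "dim (tight_space z) = dim F"
    "card (decomposable z) = CARD('a) - 1 - embdim F"
    using apery_face_point[OF F] .
  then have "card (decomposable z) = 1" using e by linarith
  then show ?thesis using dim_single_apery_ge[OF z(2) _ m] z(3) by simp
qed

lemma no_apery_face_dim_1:
  fixes F :: "(real ^ 'a::nontriv mod_ring) set"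
  assumes F: "kunz_face F" "\<not> degenerate F" "apery F"
    and m: "CARD('a) \<ge> 7" and e: "embdim F + 3 = CARD('a)"
  shows "dim F \<noteq> 1"
proof
  assume dim: "dim F = 1"
  obtain z :: "real ^ 'a mod_ring" where z: "positive_point z" "apery_point z" "dim (tight_space z) = dim F"
    "card (decomposable z) = CARD('a) - 1 - embdim F"
    using apery_face_point[OF F] .
  then have "card (decomposable z) = 2" using e by linarith
  then obtain c c' where c: "decomposable z = {c, c'}" "c \<noteq> c'" by (meson card_2_iff)
  have "z $ c \<noteq> z $ c'" using apery_point_inject[OF z(2)] c(2) by blast
  then obtain c1 c2 where c12: "decomposable z = {c1, c2}" "z $ c1 < z $ c2"
    using c(1) by (metis insert_commute linorder_neqE_linordered_idom)
  then have "c1 \<noteq> c2" by auto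
  then have "2 * CARD('a) \<le> 2 * dim (tight_space z) + 2 +
      (card (decomps z c1) + card {a \<in> decomps z c1. c1 - a = a} +
       (card (decomps z c2) + card {a \<in> decomps z c2. c2 - a = a}))"
    using codim_tight_space_le[of z] by (simp add: c12(1))
  then have "2 * CARD('a) \<le> card (decomps z c1) + card (decomps z c2) + 6"
    using card_fixed_decomps_le_1[OF z(2), of c1] card_fixed_decomps_le_1[OF z(2), of c2] z(3) dim
    by linarith
  then interpret apery_ray z c1 c2
    using z(1,2) c12 m by unfold_locales
  show False by (rule no_apery_ray)
qed

section \<open>The realizable pairs\<close>

theorem theorem4p7:
  fixes m :: nat and e d :: int
  assumes "m = CARD('a::nontriv)" and "m \<ge> 7"
  shows "let admissible =
               ((e = int m - 1 \<and> d = int m - 1) \<or>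
                (e = int m - 2 \<and> \<lfloor>(real m - 1) / 2\<rfloor> \<le> d \<and> d \<le> int m - 2) \<or>
                (2 \<le> e \<and> e \<le> int m - 3 \<and> 2 \<le> d \<and> d \<le> e));
             exceptional =
               ((even m \<and> e = int m - 2 \<and> real_of_int d = real m / 2 - 1) \<or>
                (e = int m - 3 \<and> d = 1))
         in (admissible \<longrightarrow>
               (\<exists>F :: (real ^ 'a mod_ring) set. kunz_face F \<and> \<not> degenerate F \<and>
                  int (embdim F) = e \<and> int (dim F) = d)) \<and>
            (admissible \<and> \<not> exceptional \<longrightarrow>
               (\<exists>F :: (real ^ 'a mod_ring) set. kunz_face F \<and> \<not> degenerate F \<and>
                  int (embdim F) = e \<and> int (dim F) = d \<and> apery F)) \<and>
            (exceptional \<longrightarrow>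
               (\<nexists>F :: (real ^ 'a mod_ring) set. kunz_face F \<and> \<not> degenerate F \<and>
                  int (embdim F) = e \<and> int (dim F) = d \<and> apery F))"
proof -
  let ?F = "\<lambda>F :: (real ^ 'a mod_ring) set. kunz_face F \<and> \<not> degenerate F \<and>
    int (embdim F) = e \<and> int (dim F) = d"
  have floor: "\<lfloor>(real m - 1) / 2\<rfloor> = (int m - 1) div 2"
    using floor_divide_of_int_eq[of "int m - 1" 2] by simp
  have half: "real_of_int d = real m / 2 - 1 \<longleftrightarrow> 2 * d = int m - 2"
    by linarith
  have single: "\<exists>F. ?F F \<and> apery F"
    if "0 \<le> d" "d \<le> int m - 1" "int m - 1 \<le> 2 * d" "e = (if d = int m - 1 then d else int m - 2)"
  proof -
    define s where "s = m - 1 - nat d"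
    have "2 * s \<le> m - 1" using that by (simp add: s_def)
    then obtain F :: "(real ^ 'a mod_ring) set" where "kunz_face F" "\<not> degenerate F" "apery F"
      "embdim F = (if s = 0 then m - 1 else m - 2)" "dim F = m - 1 - s"
      using exists_face_single_apery[OF assms(1), of s] assms(2) by auto
    moreover from this have "int (dim F) = d" "int (embdim F) = e"
      using that assms(2) by (auto simp: s_def split: if_splits)
    ultimately show ?thesis by blast
  qed
  have b: "(\<exists>F. ?F F \<and> apery F) \<or> (even m \<and> 2 * d = int m - 2 \<and> (\<exists>F. ?F F))"
    if e: "e = int m - 2" and d: "(int m - 1) div 2 \<le> d" "d \<le> int m - 2"
  proof (cases "int m - 1 \<le> 2 * d")
    case True
    then have "\<exists>F. ?F F \<and> apery F" using e d assms(2) by (intro single) auto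
    then show ?thesis by blast
  next
    case False
    then have m: "even m" "2 * d = int m - 2" using d by presburger+
    obtain F :: "(real ^ 'a mod_ring) set" where F: "kunz_face F" "\<not> degenerate F"
      "embdim F = m - 2" "dim F = m div 2 - 1"
      using exists_face_single_even[OF assms(1) _ m(1)] assms(2) by auto
    then have "int (dim F) = d" "int (embdim F) = e" using m e assms(2) by auto
    then show ?thesis using F m by blast
  qed
  have c: "\<exists>F. ?F F \<and> apery F" if "2 \<le> e" "e \<le> int m - 3" "2 \<le> d" "d \<le> e"
  proof -
    \<comment> \<open>Solves \<open>e = m - 1 - (n - q)\<close> and \<open>d = 2 + (m - 1 - n)\<close>.\<close>
    define q n where "q = nat (e + 2 - d)" and "n = nat (int m + 1 - d)"
    have "2 \<le> q" "q + 2 \<le> n" "n \<le> m - 1"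
      using that by (simp_all add: q_def n_def nat_le_iff le_nat_iff flip: nat_add_distrib)
    then obtain F :: "(real ^ 'a mod_ring) set" where F: "kunz_face F" "\<not> degenerate F" "apery F"
      "embdim F = m - 1 - (n - q)" "dim F = 2 + (m - 1 - n)"
      using exists_face_two_parameters[OF assms(1)] by blast
    then have "int (dim F) = d" "int (embdim F) = e"
      using that by (simp_all add: q_def n_def)
    then show ?thesis using F by blast
  qed
  have no_even: "\<not> (?F F \<and> apery F)" if "even m" "e = int m - 2" "2 * d = int m - 2" for F
    using no_apery_face_dim_half[of F] that assms by force
  have no_ray: "\<not> (?F F \<and> apery F)" if "e = int m - 3" "d = 1" for F
    using no_apery_face_dim_1[of F] that assms by force
  let ?adm = "(e = int m - 1 \<and> d = int m - 1) \<or>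
    (e = int m - 2 \<and> (int m - 1) div 2 \<le> d \<and> d \<le> int m - 2) \<or>
    (2 \<le> e \<and> e \<le> int m - 3 \<and> 2 \<le> d \<and> d \<le> e)"
  let ?exc = "(even m \<and> e = int m - 2 \<and> 2 * d = int m - 2) \<or> (e = int m - 3 \<and> d = 1)"
  have adm: "(\<exists>F. ?F F \<and> apery F) \<or> (?exc \<and> (\<exists>F. ?F F))" if ?adm
    using that
  proof (elim disjE conjE)
    assume "e = int m - 1" "d = int m - 1"
    then have "\<exists>F. ?F F \<and> apery F" using assms(2) by (intro single) auto
    then show ?thesis by blast
  next
    assume "e = int m - 2" "(int m - 1) div 2 \<le> d" "d \<le> int m - 2"
    then show ?thesis using b by blast
  next
    assume "2 \<le> e" "e \<le> int m - 3" "2 \<le> d" "d \<le> e"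
    then show ?thesis using c by blast
  qed
  have exc: "\<not> (?F F \<and> apery F)" if ?exc for F
    using that no_even no_ray by blast
  show ?thesis
    unfolding Let_def floor half
  proof (intro conjI impI)
    assume ?adm
    then show "\<exists>F. ?F F" using adm by blast
  next
    assume "?adm \<and> \<not> ?exc"
    then show "\<exists>F :: (real ^ 'a mod_ring) set. kunz_face F \<and> \<not> degenerate F \<and>
        int (embdim F) = e \<and> int (dim F) = d \<and> apery F"
      using adm by blast
  next
    assume ?exc
    then show "\<nexists>F :: (real ^ 'a mod_ring) set. kunz_face F \<and> \<not> degenerate F \<and>
        int (embdim F) = e \<and> int (dim F) = d \<and> apery F"
      using exc by blast
  qed
qed

end
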